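(* For every integer $n\ge 0$, with $a_n(s,t)$ and the $(n+1)\times(n+1)$ matrices $\mathbf{M}_{n,r}$ ($r\ge 0$) defined as in the context, $$a_n(s,t)=-\frac{(1+t^{n+1})(1-s)^n}{t}+\frac{(1-s)^{n+1}}{t}\sum_{r\ge 0}s^r\det(\mathbf{M}_{n,r}),$$ as an identity of formal power series in $s$ with coefficients in $\mathbb{Q}(t)$.
   Context: $\mathfrak{S}_n$ is the set of permutations $\pi=\pi(1)\cdots\pi(n)$ of $\{1,\dots,n\}$. $\mathrm{des}(\pi)$ is the number of $i\in\{1,\dots,n-1\}$ with $\pi(i)>\pi(i+1)$, and $\mathrm{exc}(\pi)$ is the number of $i\in\{1,\dots,n\}$ with $\pi(i)>i$. For $n\ge 1$ put $$A_n(s,t)=\sum_{\pi\in\mathfrak{S}_n}s^{\mathrm{des}(\pi)}t^{\mathrm{exc}(\pi)},\qquad a_n(s,t)=\frac{A_n(s,t)-t^nA_n(s,1/t)}{1-t}$$ (which is a polynomial in $s,t$), and set $a_0(s,t)=0$. Write $[m]_t=\frac{1-t^m}{1-t}$. For an integer $x$ (possibly negative) and $j\ge 0$, $\binom{x}{j}=\frac{x(x-1)\cdots(x-j+1)}{j!}$; in particular $\binom{-1}{j}=(-1)^j$. For a fixed integer $r\ge 0$ and all $j\ge 0$, let $$\alpha_j=(-1)^j\binom{r}{j}[j+1]_t,\qquad \beta_j=(-1)^j\binom{r-1}{j}[j+2]_t,$$ and let $\alpha_j=0$ for $j<0$. The matrix $\mathbf{M}_{n,r}=(m_{ij})_{0\le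 i,j\le n}$ is the $(n+1)\times(n+1)$ matrix with $m_{ij}=\alpha_{i-j}$ for $0\le i\le n$, $0\le j\le n-1$, and $m_{in}=\beta_i$ for $0\le i\le n$ (last column). *)

theory Defs
  imports
    "HOL-Combinatorics.Permutations"
    "HOL-Computational_Algebra.Formal_Power_Series"
    "HOL-Computational_Algebra.Polynomial_Factorial"
    "Jordan_Normal_Form.Determinant"
begin

definition des :: "nat \<Rightarrow> (nat \<Rightarrow> nat) \<Rightarrow> nat" where
  "des n \<pi> = card {i \<in> {1..<n}. \<pi> i > \<pi> (i + 1)}"

definition exc :: "nat \<Rightarrow> (nat \<Rightarrow> nat) \<Rightarrow> nat" where
  "exc n \<pi> = card {i \<in> {1..n}. \<pi> i > i}"

(* The polynomial A_n(s,t) as a function of s and t, so that it can be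
   evaluated at t and at 1/t. *)
definition A_poly :: "nat \<Rightarrow> 'a::comm_ring_1 \<Rightarrow> 'a \<Rightarrow> 'a" where
  "A_poly n s t = (\<Sum>\<pi> | \<pi> permutes {1..n}. s ^ des n \<pi> * t ^ exc n \<pi>)"

instance fract :: ("{idom, ring_char_0}") field_char_0
proof
  show "inj (of_nat :: nat \<Rightarrow> 'a fract)"
    by (rule injI) (simp add: of_nat_fract eq_fract)
qed

type_synonym Qt = "rat poly fract"

definition tvar :: Qt where
  "tvar = to_fract [:0, 1:]"

(* a_n(s,t) in Q(t)[[s]]; the divisor 1 - t is a nonzero constant of Q(t),
   hence a unit of Q(t)[[s]]. *)
definition a_poly :: "nat \<Rightarrow> Qt fps" where
  "a_poly n =
     (if n = 0 then 0
      else (A_poly n fps_X (fps_const tvar)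
              - fps_const tvar ^ n * A_poly n fps_X (fps_const (1 / tvar)))
           / (1 - fps_const tvar))"

definition tbracket :: "nat \<Rightarrow> Qt" where
  "tbracket m = (1 - tvar ^ m) / (1 - tvar)"

(* The binomial coefficients are generalised ones in Q(t), so the upper argument
   r - 1 is -1 for r = 0. *)
definition alpha :: "nat \<Rightarrow> int \<Rightarrow> Qt" where
  "alpha r k =
     (if k < 0 then 0
      else (-1) ^ nat k * (of_nat r gchoose nat k) * tbracket (nat k + 1))"

definition beta :: "nat \<Rightarrow> nat \<Rightarrow> Qt" where
  "beta r j = (-1) ^ j * ((of_nat r - 1) gchoose j) * tbracket (j + 2)"

definition M_mat :: "nat \<Rightarrow> nat \<Rightarrow> Qt mat" where
  "M_mat n r =
     mat (n + 1) (n + 1) (\<lambda>(i, j). if j < n then alpha r (int i - int j) else beta r i)"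

end

theory Submission
  imports Defs "HOL-Combinatorics.Multiset_Permutations"
begin

text \<open>
  We have \<open>A\<^sub>n(s, t) / (1 - s)\<^bsup>n + 1\<^esup> = \<Sum>\<^sub>r s\<^sup>r w\<^sub>n(r)\<close>, where \<open>w\<^sub>n(r)\<close> is the sum of \<open>t\<^bsup>exc\<^esup>\<close> over
  permutations whose word is factored into \<open>r + 1\<close> increasing, possibly empty, blocks.
  Within an increasing block the non-excedances precede the excedances, so every block splits into
  a part \<open>P\<close> (non-excedances, weight \<open>p\<close>) and a part \<open>E\<close> (excedances, weight \<open>q\<close>).
  Cut the permutation after each part, at position \<open>T\<close> say, and record only the number \<open>h\<close> of
  positions up to \<open>T\<close> whose value exceeds \<open>T\<close>.  If \<open>u\<close> marks \<open>T\<close>, then passing \<open>P\<close> and \<open>E\<close>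
  preserves the families of series of the form \<open>\<lambda> C\<^sup>h / D\<^bsup>h + 1\<^esup>\<close> (\<open>h = 0, 1, \<dots>\<close>) and acts on
  \<open>(C, D)\<close> linearly; iterating gives
  \<open>\<Sum>\<^sub>n w\<^sub>n(r) u\<^sup>n = (p - q) b\<^sup>r / (a (p a\<^sup>r - q b\<^sup>r))\<close> with \<open>a = 1 - p u\<close> and \<open>b = 1 - q u\<close>.
  On the other side \<open>M\<close> is a triangular Toeplitz matrix times an identity matrix with modified last
  column, so its determinant is the coefficient of \<open>u\<^sup>n\<close> in \<open>(\<Sum>\<^sub>j \<beta>\<^sub>j u\<^sup>j) / (\<Sum>\<^sub>j \<alpha>\<^sub>j u\<^sup>j)\<close>.
\<close>

section \<open>Factorizations of words into monotone blocks\<close>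

text \<open>Words are read from right to left: the head of a list is the last letter of the word, and the
  head of \<open>x # xs\<close> stands at position \<open>Suc (length xs)\<close>.  Increasing blocks become decreasing lists.\<close>

fun rdes :: "nat list \<Rightarrow> nat" where
  "rdes (x # y # ys) = of_bool (x < y) + rdes (y # ys)"
| "rdes _ = 0"

fun exc_weight :: "'a::comm_ring_1 \<Rightarrow> 'a \<Rightarrow> nat list \<Rightarrow> 'a" where
  "exc_weight p q [] = 1"
| "exc_weight p q (x # xs) = (if x > Suc (length xs) then q else p) * exc_weight p q xs"

abbreviation dec_prefixes :: "nat list \<Rightarrow> nat set" where
  "dec_prefixes xs \<equiv> {j. j \<le> length xs \<and> sorted_wrt (>) (take j xs)}"

text \<open>\<open>j\<close> is the length of the first block, so this counts the ways to cut the
  list into \<open>k\<close> strictly decreasing blocks. Blocks may be empty, which is why the empty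
  list has one factorization for every \<open>k\<close>.\<close>

fun num_factorizations :: "nat \<Rightarrow> nat list \<Rightarrow> nat" where
  "num_factorizations 0 xs = of_bool (xs = [])"
| "num_factorizations (Suc k) xs = (\<Sum>j\<in>dec_prefixes xs. num_factorizations k (drop j xs))"

lemma finite_dec_prefixes [simp]: "finite (dec_prefixes xs)"
  by (rule finite_subset[of _ "{..length xs}"]) auto

lemma sum_dec_prefixes_Cons:
  "(\<Sum>j\<in>dec_prefixes (x # ys). f j) =
     f 0 + (\<Sum>j | j \<in> dec_prefixes ys \<and> (\<forall>y\<in>set (take j ys). y < x). f (Suc j))"
proof -
  have eq: "dec_prefixes (x # ys) =
      insert 0 (Suc ` {j. j \<in> dec_prefixes ys \<and> (\<forall>y\<in>set (take j ys). y < x)})"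
  proof (rule Set.set_eqI)
    fix j show "j \<in> dec_prefixes (x # ys) \<longleftrightarrow>
      j \<in> insert 0 (Suc ` {j. j \<in> dec_prefixes ys \<and> (\<forall>y\<in>set (take j ys). y < x)})"
      by (cases j) auto
  qed
  have "finite {j. j \<in> dec_prefixes ys \<and> (\<forall>y\<in>set (take j ys). y < x)}"
    by (rule finite_subset[OF _ finite_dec_prefixes[of ys]]) auto
  then show ?thesis unfolding eq
    by (subst sum.insert) (auto simp: sum.reindex)
qed

lemma num_factorizations_Nil [simp]: "num_factorizations k [] = 1"
proof (induction k)
  case (Suc k)
  have "dec_prefixes [] = {0}" by auto
  with Suc show ?case by simp
qed simp

lemma num_factorizations_Suc_single: "num_factorizations (Suc k) [x] = num_factorizations k [x] + 1"
proof -
  have "{j. j \<in> dec_prefixes [] \<and> (\<forall>y\<in>set (take j []). y < x)} = {0}" by auto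
  then show ?thesis by (simp only: num_factorizations.simps sum_dec_prefixes_Cons) simp
qed

text \<open>The first block is empty (first summand) or starts with \<open>x\<close>. In the latter
  case it is just \<open>[x]\<close> if \<open>x < y\<close>; if \<open>x > y\<close>, deleting
  \<open>x\<close> is a bijection onto the factorizations of \<open>y # ys\<close> into
  \<open>Suc k\<close> blocks.\<close>

lemma num_factorizations_Suc_Cons_Cons:
  assumes "x \<noteq> y"
  shows "num_factorizations (Suc k) (x # y # ys) =
    num_factorizations k (x # y # ys) + (if x < y then num_factorizations k (y # ys) else num_factorizations (Suc k) (y # ys))"
proof (cases "x < y")
  case True
  have "{j. j \<in> dec_prefixes (y # ys) \<and> (\<forall>z\<in>set (take j (y # ys)). z < x)} = {0}"
  proof (rule Set.set_eqI)
    fix j show "j \<in> {j. j \<in> dec_prefixes (y # ys) \<and> (\<forall>z\<in>set (take j (y # ys)). z < x)} \<longleftrightarrow> j \<in> {0}"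
      using True by (cases j) auto
  qed
  then show ?thesis using True
    by (simp only: num_factorizations.simps sum_dec_prefixes_Cons[of _ x]) simp
next
  case False
  have "{j. j \<in> dec_prefixes (y # ys) \<and> (\<forall>z\<in>set (take j (y # ys)). z < x)} = dec_prefixes (y # ys)"
  proof (rule Set.set_eqI)
    fix j show "j \<in> {j. j \<in> dec_prefixes (y # ys) \<and> (\<forall>z\<in>set (take j (y # ys)). z < x)} \<longleftrightarrow> j \<in> dec_prefixes (y # ys)"
      using False assms by (cases j) auto
  qed
  then show ?thesis using False
    by (simp only: num_factorizations.simps sum_dec_prefixes_Cons[of _ x]) simp
qed

lemma fps_one_minus_X_mult_nth:
  fixes f :: "nat \<Rightarrow> 'a::comm_ring_1"
  shows "(1 - fps_X) * Abs_fps f = Abs_fps (\<lambda>k. f k - (if k = 0 then 0 else f (k - 1)))"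
  by (rule fps_ext) (auto simp: ring_distribs)

text \<open>By the recursion, multiplying by \<open>1 - X\<close> removes the head and leaves a
  factor \<open>X\<close> exactly at a descent of the word, that is, where \<open>x < y\<close> in
  the reversed list. The base cases are \<open>1/(1 - X)\<close> and
  \<open>1/(1 - X)^2\<close>.\<close>

lemma num_factorizations_gf:
  assumes "distinct xs"
  shows "Abs_fps (\<lambda>r. of_nat (num_factorizations (Suc r) xs)) * (1 - fps_X) ^ Suc (length xs)
       = (fps_X ^ rdes xs :: 'a::comm_ring_1 fps)"
  using assms
proof (induction xs rule: rdes.induct)
  case (1 x y ys)
  let ?G = "\<lambda>xs. Abs_fps (\<lambda>r. of_nat (num_factorizations (Suc r) xs)) :: 'a fps"
  have "(1 - fps_X) * ?G (x # y # ys) = (if x < y then fps_X else 1) * ?G (y # ys)"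
  proof (rule fps_ext)
    fix n
    show "fps_nth ((1 - fps_X) * ?G (x # y # ys)) n = fps_nth ((if x < y then fps_X else 1) * ?G (y # ys)) n"
      using 1 by (cases n) (auto simp add: fps_one_minus_X_mult_nth num_factorizations_Suc_Cons_Cons simp del: num_factorizations.simps(2)) 
  qed
  moreover have "?G (x # y # ys) * (1 - fps_X) ^ Suc (length (x # y # ys)) =
      (1 - fps_X) * ?G (x # y # ys) * (1 - fps_X) ^ Suc (length (y # ys))"
    by (simp only: length_Cons power_Suc mult_ac)
  ultimately have "?G (x # y # ys) * (1 - fps_X) ^ Suc (length (x # y # ys)) =
      (if x < y then fps_X else 1) * (?G (y # ys) * (1 - fps_X) ^ Suc (length (y # ys)))"
    by (simp only: mult.assoc)
  also have "\<dots> = (if x < y then fps_X else 1) * fps_X ^ rdes (y # ys)"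
    using 1 by simp
  finally show ?case by simp
next
  case "2_1"
  have "(1 - fps_X) * Abs_fps (\<lambda>r. of_nat (num_factorizations (Suc r) [])) = (1 :: 'a fps)"
    unfolding fps_one_minus_X_mult_nth by (rule fps_ext) (simp del: num_factorizations.simps)
  then show ?case by (simp add: mult.commute del: num_factorizations.simps)
next
  case ("2_2" x)
  have n: "num_factorizations (Suc r) [x] = Suc r" for r
    by (induction r) (simp_all add: num_factorizations_Suc_single del: num_factorizations.simps(2))
  have "(1 - fps_X) * ((1 - fps_X) * Abs_fps (\<lambda>r. of_nat (num_factorizations (Suc r) [x]))) = (1 :: 'a fps)"
    unfolding fps_one_minus_X_mult_nth n by (rule fps_ext) (auto simp del: num_factorizations.simps simp: gr0_conv_Suc)
  then show ?case by (simp add: mult_ac power2_eq_square del: num_factorizations.simps)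
qed

lemma rev_sorted_list_of_set_eq:
  "sorted_wrt (>) xs \<Longrightarrow> rev (sorted_list_of_set (set xs)) = xs"
proof -
  assume "sorted_wrt (>) xs"
  then have "sorted_wrt (<) (rev xs)" by (simp add: sorted_wrt_rev)
  then have "sorted (rev xs)" "distinct (rev xs)" using strict_sorted_iff by blast+
  then have "sorted_list_of_set (set (rev xs)) = rev xs"
    by (intro sorted_list_of_set.idem_if_sorted_distinct) auto
  then show ?thesis by simp
qed

text \<open>A decreasing list is determined by its set of letters. Choosing a permutation of
  \<open>V\<close> with a decreasing prefix thus amounts to choosing a subset \<open>S\<close> and
  an arrangement of \<open>V - S\<close>.\<close>

lemma sum_permutations_dec_prefixes:
  fixes f :: "nat list \<Rightarrow> nat list \<Rightarrow> 'a::comm_monoid_add"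
  assumes "finite V"
  shows "(\<Sum>xs\<in>permutations_of_set V. \<Sum>j\<in>dec_prefixes xs. f (take j xs) (drop j xs)) =
    (\<Sum>S\<in>Pow V. \<Sum>ys\<in>permutations_of_set (V - S). f (rev (sorted_list_of_set S)) ys)"
proof -
  have fin: "finite S" if "S \<subseteq> V" for S using assms finite_subset that by blast
  have "(\<Sum>(xs, j)\<in>(SIGMA xs:permutations_of_set V. dec_prefixes xs). f (take j xs) (drop j xs)) =
    (\<Sum>(S, ys)\<in>(SIGMA S:Pow V. permutations_of_set (V - S)). f (rev (sorted_list_of_set S)) ys)"
  proof (rule sum.reindex_bij_witness[where
        i = "\<lambda>(S, ys). (rev (sorted_list_of_set S) @ ys, card S)" and
        j = "\<lambda>(xs, j). (set (take j xs), drop j xs)"], goal_cases)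
    case (1 a)
    then obtain xs j where a: "a = (xs, j)" "set xs = V" "distinct xs" "j \<le> length xs"
      "sorted_wrt (>) (take j xs)" by (auto simp: permutations_of_set_def)
    then show ?case by (simp add: rev_sorted_list_of_set_eq distinct_card)
  next
    case (2 a)
    then obtain xs j where a: "a = (xs, j)" "set xs = V" "distinct xs" "j \<le> length xs"
      "sorted_wrt (>) (take j xs)" by (auto simp: permutations_of_set_def)
    have "set xs = set (take j xs) \<union> set (drop j xs)"
      by (metis append_take_drop_id set_append)
    moreover have "set (take j xs) \<inter> set (drop j xs) = {}"
      using a by (metis append_take_drop_id distinct_append)
    ultimately have "set (drop j xs) = V - set (take j xs)" using a by blast
    then show ?case using a by (auto simp: permutations_of_set_def dest: in_set_takeD)
  next
    case (3 b)
    then show ?case using fin by auto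
  next
    case (4 b)
    then obtain S ys where b: "b = (S, ys)" "S \<subseteq> V" "set ys = V - S" "distinct ys"
      by (auto simp: permutations_of_set_def)
    then show ?case using fin[of S]
      by (auto simp: permutations_of_set_def sorted_wrt_rev)
  next
    case (5 a)
    then obtain xs j where a: "a = (xs, j)" "set xs = V" "distinct xs" "j \<le> length xs"
      "sorted_wrt (>) (take j xs)" by (auto simp: permutations_of_set_def)
    then show ?case by (simp add: rev_sorted_list_of_set_eq)
  qed
  then show ?thesis using assms by (simp add: sum.Sigma)
qed

section \<open>Peeling off a block\<close>

text \<open>\<open>V\<close> is arbitrary because the values left after peeling off a block need not
  form an interval. Two separate weights are kept so that the passage from \<open>t\<close> to
  \<open>1/t\<close> becomes the exchange of \<open>p\<close> and \<open>q\<close>.\<close>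

definition weighted_count :: "'a::comm_ring_1 \<Rightarrow> 'a \<Rightarrow> nat \<Rightarrow> nat set \<Rightarrow> 'a" where
  "weighted_count p q k V = (\<Sum>xs\<in>permutations_of_set V. of_nat (num_factorizations k xs) * exc_weight p q xs)"

text \<open>Here \<open>n\<close> is the position of the head.\<close>

fun block_weight :: "'a::comm_ring_1 \<Rightarrow> 'a \<Rightarrow> nat \<Rightarrow> nat list \<Rightarrow> 'a" where
  "block_weight p q n [] = 1"
| "block_weight p q n (x # xs) = (if x > n then q else p) * block_weight p q (n - 1) xs"

lemma exc_weight_append: "exc_weight p q (xs @ ys) = block_weight p q (length xs + length ys) xs * exc_weight p q ys"
  by (induction xs) (auto simp: mult_ac)

text \<open>\<open>P\<close> and \<open>E\<close> are the sets of values of a block placed on top of a word, \<open>V\<close> is the set of all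
  values afterwards.  An increasing block consists of non-excedances iff its largest value is at most
  its last position \<open>card V\<close>, and of excedances iff its least value exceeds its first position.\<close>

definition stepP :: "'a::comm_ring_1 \<Rightarrow> (nat set \<Rightarrow> 'a) \<Rightarrow> nat set \<Rightarrow> 'a" where
  "stepP p F V = (\<Sum>P | P \<subseteq> V \<and> (\<forall>x\<in>P. x \<le> card V). p ^ card P * F (V - P))"

definition stepE :: "'a::comm_ring_1 \<Rightarrow> (nat set \<Rightarrow> 'a) \<Rightarrow> nat set \<Rightarrow> 'a" where
  "stepE q F V = (\<Sum>E | E \<subseteq> V \<and> (\<forall>x\<in>E. x > Suc (card V - card E)). q ^ card E * F (V - E))"

text \<open>\<open>E\<close> collects the excedances of a block \<open>S\<close> whose last position
  is \<open>n\<close>: they occupy the last \<open>card E\<close> positions, the first of which is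
  \<open>Suc (n - card E)\<close>.\<close>

abbreviation splits :: "nat \<Rightarrow> nat set \<Rightarrow> nat set set" where
  "splits n S \<equiv> {E. E \<subseteq> S \<and> (\<forall>x\<in>E. x > Suc (n - card E)) \<and> (\<forall>x\<in>S - E. x \<le> n - card E)}"

text \<open>A nonempty \<open>E\<close> would lie in an interval with fewer than
  \<open>card E\<close> elements.\<close>

lemma splits_le:
  assumes "\<forall>x\<in>S. x \<le> n"
  shows "splits n S = {{}}"
proof -
  have "E = {}" if E: "E \<subseteq> S" "\<forall>x\<in>E. x > Suc (n - card E)" for E
  proof (rule ccontr)
    assume "E \<noteq> {}"
    have sub: "E \<subseteq> {Suc (n - card E)<..n}" using E assms by auto
    then have "card E \<le> n - Suc (n - card E)"
      using card_mono[OF _ sub] by simp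
    moreover have "card E > 0" using sub finite_subset \<open>E \<noteq> {}\<close> card_gt_0_iff by blast
    ultimately show False by linarith
  qed
  then show ?thesis using assms by auto
qed

lemma rev_sorted_list_of_set_insert:
  assumes "finite A" "\<forall>a\<in>A. a < (b::nat)"
  shows "rev (sorted_list_of_set (insert b A)) = b # rev (sorted_list_of_set A)"
proof -
  have "sorted_wrt (>) (b # rev (sorted_list_of_set A))"
    using assms by (auto simp: sorted_wrt_rev)
  from rev_sorted_list_of_set_eq[OF this] show ?thesis using assms by simp
qed

text \<open>Exactly one \<open>E\<close> qualifies, the set of actual excedances; writing its weight
  as a sum allows the pair \<open>(S, E)\<close> to be traded for \<open>(E, P)\<close> later. The
  induction removes the maximum, which stands at position \<open>n\<close>: if it exceeds
  \<open>n\<close> it must belong to \<open>E\<close>, otherwise the block has no excedance at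
  all.\<close>

lemma block_weight_eq_sum_splits:
  assumes "finite S" "card S \<le> n"
  shows "block_weight p q n (rev (sorted_list_of_set S)) = (\<Sum>E\<in>splits n S. q ^ card E * p ^ card (S - E))"
  using assms
proof (induction S arbitrary: n rule: finite_linorder_max_induct)
  case empty
  have "splits n {} = {{}}" by auto
  then show ?case by simp
next
  case (insert b A)
  have nb: "b \<notin> A" using insert.hyps by auto
  have n: "card A \<le> n - 1" "n > 0" using insert.prems insert.hyps(1) nb by simp_all
  show ?case
  proof (cases "b > n")
    case True
    have eq: "splits n (insert b A) = insert b ` splits (n - 1) A"
    proof (intro Set.set_eqI iffI)
      fix E assume "E \<in> splits n (insert b A)"
      then have E: "E \<subseteq> insert b A" "\<forall>x\<in>E. x > Suc (n - card E)" "\<forall>x\<in>insert b A - E. x \<le> n - card E"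
        by auto
      have "b \<in> E" using E(3) True by (meson DiffI diff_le_self insertI1 le_trans not_le)
      have "finite E" using E(1) insert.hyps finite_subset by auto
      with \<open>b \<in> E\<close> have c: "card E = Suc (card (E - {b}))" by (simp add: card_Suc_Diff1 del: card_Diff_insert)
      have "E = insert b (E - {b})" "E - {b} \<in> splits (n - 1) A"
        using E \<open>b \<in> E\<close> nb by (auto simp: c simp del: card_Diff_insert)
      then show "E \<in> insert b ` splits (n - 1) A" by blast
    next
      fix E assume "E \<in> insert b ` splits (n - 1) A"
      then obtain E' where E': "E = insert b E'" "E' \<in> splits (n - 1) A" by blast
      then have "finite E'" "b \<notin> E'" using insert.hyps finite_subset nb by auto
      then have "card E = Suc (card E')" using E' by simp
      then show "E \<in> splits n (insert b A)" using E' True n by auto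
    qed
    have inj: "inj_on (insert b) (splits (n - 1) A)" using nb by (auto intro!: inj_onI) 
    have "(\<Sum>E\<in>splits n (insert b A). q ^ card E * p ^ card (insert b A - E)) =
       (\<Sum>E\<in>splits (n - 1) A. q ^ card (insert b E) * p ^ card (insert b A - insert b E))"
      unfolding eq by (subst sum.reindex[OF inj]) simp
    also have "\<dots> = (\<Sum>E\<in>splits (n - 1) A. q * (q ^ card E * p ^ card (A - E)))"
    proof (rule sum.cong[OF refl])
      fix E assume "E \<in> splits (n - 1) A"
      then have "finite E" "b \<notin> E" "insert b A - insert b E = A - E"
        using insert.hyps finite_subset nb by auto
      then show "q ^ card (insert b E) * p ^ card (insert b A - insert b E) = q * (q ^ card E * p ^ card (A - E))"
        by (simp add: mult.assoc)
    qed
    also have "\<dots> = q * block_weight p q (n - 1) (rev (sorted_list_of_set A))"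
      by (simp only: insert.IH[OF n(1)] sum_distrib_left)
    finally show ?thesis using True
      by (simp only: rev_sorted_list_of_set_insert[OF insert.hyps] block_weight.simps if_True)
  next
    case False
    then have s: "splits n (insert b A) = {{}}" "splits (n - 1) A = {{}}"
      using insert.hyps by (intro splits_le; fastforce)+
    show ?thesis using False nb insert.hyps(1)
      by (simp only: rev_sorted_list_of_set_insert[OF insert.hyps] block_weight.simps insert.IH[OF n(1)] s) simp
  qed
qed

lemma weighted_count_0: "finite V \<Longrightarrow> weighted_count p q 0 V = of_bool (V = {})"
proof -
  assume "finite V"
  have "weighted_count p q 0 V = (\<Sum>xs\<in>permutations_of_set V. if [] = xs then 1 else 0)"
    unfolding weighted_count_def by (rule sum.cong) auto
  also have "\<dots> = of_bool ([] \<in> permutations_of_set V)"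
    by (subst sum.delta') simp_all
  finally show ?thesis by (simp add: permutations_of_set_def eq_commute)
qed

text \<open>The value set \<open>S\<close> of the last block is the disjoint union of
  \<open>E\<close> and \<open>P\<close>. Since \<open>card (V - E) = card V - card E\<close>, the
  bound on \<open>S - E\<close> in \<open>splits\<close> is the bound that \<open>stepP\<close>
  imposes on subsets of \<open>V - E\<close>, so the sum over \<open>(S, E)\<close> becomes one over
  \<open>(E, P)\<close>.\<close>

lemma weighted_count_Suc:
  assumes fin: "finite V"
  shows "weighted_count p q (Suc k) V = stepE q (stepP p (weighted_count p q k)) V"
proof -
  have finS: "finite S" if "S \<subseteq> V" for S using fin finite_subset that by blast
  have "weighted_count p q (Suc k) V = (\<Sum>xs\<in>permutations_of_set V. \<Sum>j\<in>dec_prefixes xs.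
      of_nat (num_factorizations k (drop j xs)) * exc_weight p q (take j xs @ drop j xs))"
    unfolding weighted_count_def by (simp add: sum_distrib_right)
  also have "\<dots> = (\<Sum>S\<in>Pow V. \<Sum>ys\<in>permutations_of_set (V - S).
      of_nat (num_factorizations k ys) * exc_weight p q (rev (sorted_list_of_set S) @ ys))"
    by (rule sum_permutations_dec_prefixes[OF fin])
  also have "\<dots> = (\<Sum>S\<in>Pow V. \<Sum>E\<in>splits (card V) S. q ^ card E * p ^ card (S - E) * weighted_count p q k (V - S))"
  proof (rule sum.cong[OF refl])
    fix S assume "S \<in> Pow V"
    then have S: "S \<subseteq> V" "finite S" using finS by auto
    have len: "length (rev (sorted_list_of_set S)) + length ys = card V"
      if "ys \<in> permutations_of_set (V - S)" for ys
      using S fin that card_mono[OF fin S(1)]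
      by (simp add: length_finite_permutations_of_set card_Diff_subset)
    have "(\<Sum>ys\<in>permutations_of_set (V - S). of_nat (num_factorizations k ys) * exc_weight p q (rev (sorted_list_of_set S) @ ys))
      = (\<Sum>ys\<in>permutations_of_set (V - S). block_weight p q (card V) (rev (sorted_list_of_set S)) *
           (of_nat (num_factorizations k ys) * exc_weight p q ys))"
      by (rule sum.cong[OF refl]) (simp only: exc_weight_append len mult_ac)
    also have "\<dots> = block_weight p q (card V) (rev (sorted_list_of_set S)) * weighted_count p q k (V - S)"
      by (simp add: weighted_count_def sum_distrib_left)
    finally show "(\<Sum>ys\<in>permutations_of_set (V - S). of_nat (num_factorizations k ys) * exc_weight p q (rev (sorted_list_of_set S) @ ys))
      = (\<Sum>E\<in>splits (card V) S. q ^ card E * p ^ card (S - E) * weighted_count p q k (V - S))"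
      by (simp only: block_weight_eq_sum_splits[OF S(2) card_mono[OF fin S(1)]] sum_distrib_right)
  qed
  also have "\<dots> = (\<Sum>(S, E)\<in>(SIGMA S:Pow V. splits (card V) S). q ^ card E * p ^ card (S - E) * weighted_count p q k (V - S))"
    using fin finS by (subst sum.Sigma) simp_all
  also have "\<dots> = (\<Sum>(E, P)\<in>(SIGMA E:{E. E \<subseteq> V \<and> (\<forall>x\<in>E. x > Suc (card V - card E))}.
      {P. P \<subseteq> V - E \<and> (\<forall>x\<in>P. x \<le> card (V - E))}). q ^ card E * (p ^ card P * weighted_count p q k (V - E - P)))"
  proof (rule sum.reindex_bij_witness[where
      i = "\<lambda>(E, P). (E \<union> P, E)" and j = "\<lambda>(S, E). (E, S - E)"], goal_cases)
    case (1 x)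
    then show ?case by auto
  next
    case (2 x)
    then obtain S E where x: "x = (S, E)" "S \<subseteq> V" "E \<subseteq> S"
      and E: "\<forall>y\<in>E. y > Suc (card V - card E)" "\<forall>y\<in>S - E. y \<le> card V - card E"
      by auto
    have "card (V - E) = card V - card E" using x finS[of E] by (simp add: card_Diff_subset)
    with x E show ?case by auto
  next
    case (3 y)
    then show ?case by auto
  next
    case (4 y)
    then obtain E P where y: "y = (E, P)" "E \<subseteq> V" "P \<subseteq> V - E"
      and E: "\<forall>x\<in>E. x > Suc (card V - card E)" "\<forall>x\<in>P. x \<le> card (V - E)"
      by auto
    have "card (V - E) = card V - card E" using y finS[of E] by (simp add: card_Diff_subset)
    with y E show ?case by auto
  next
    case (5 x)
    then obtain S E where x: "x = (S, E)" by (cases x) auto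
    with 5 have "E \<subseteq> S" "S \<subseteq> V" by auto
    then have "V - E - (S - E) = V - S" by blast
    with x show ?case by (simp add: mult.assoc)
  qed
  also have "\<dots> = stepE q (stepP p (weighted_count p q k)) V"
    unfolding stepE_def stepP_def sum_distrib_left
    using fin by (subst sum.Sigma) auto
  finally show ?thesis .
qed

section \<open>Transfer on subset sums\<close>

text \<open>The values of \<open>V\<close> above \<open>card V\<close> matter only through their number.\<close>

definition represents :: "(nat set \<Rightarrow> 'a) \<Rightarrow> (nat \<Rightarrow> nat set \<Rightarrow> 'a) \<Rightarrow> bool" where
  "represents F G \<longleftrightarrow> (\<forall>V. finite V \<and> 0 \<notin> V \<longrightarrow> F V = G (card V) (V \<inter> {1..card V}))"

definition shape_stepP :: "'a::comm_ring_1 \<Rightarrow> (nat \<Rightarrow> nat set \<Rightarrow> 'a) \<Rightarrow> nat \<Rightarrow> nat set \<Rightarrow> 'a" where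
  "shape_stepP p G N W = (\<Sum>P\<in>Pow W. p ^ card P * G (N - card P) ((W - P) \<inter> {1..N - card P}))"

text \<open>The \<open>e\<close> values of the part must exceed its first position
  \<open>Suc (N - e)\<close>. For \<open>e > 0\<close> the upper entry of the binomial coefficient
  is the number of values that do, and every choice leaves the values up to \<open>N - e\<close>
  unchanged.\<close>

definition shape_stepE :: "'a::comm_ring_1 \<Rightarrow> (nat \<Rightarrow> nat set \<Rightarrow> 'a) \<Rightarrow> nat \<Rightarrow> nat set \<Rightarrow> 'a" where
  "shape_stepE q G N W = (\<Sum>e\<le>N. q ^ e * of_nat ((N - card (W \<inter> {1..Suc (N - e)})) choose e) *
     G (N - e) (W \<inter> {1..N - e}))"

lemma represents_weighted_count_0: "represents (weighted_count p q 0) (\<lambda>T W. of_bool (T = 0))"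
  by (auto simp: represents_def weighted_count_0)

lemma represents_stepP:
  assumes "represents F G"
  shows "represents (stepP p F) (shape_stepP p G)"
  unfolding represents_def
proof (intro allI impI)
  fix V :: "nat set" assume V: "finite V \<and> 0 \<notin> V"
  let ?N = "card V" and ?W = "V \<inter> {1..card V}"
  have "{P. P \<subseteq> V \<and> (\<forall>x\<in>P. x \<le> ?N)} = Pow ?W"
  proof (intro Set.set_eqI iffI)
    fix P assume P: "P \<in> {P. P \<subseteq> V \<and> (\<forall>x\<in>P. x \<le> ?N)}"
    have "x \<in> ?W" if "x \<in> P" for x
    proof -
      have "x \<in> V" "x \<le> ?N" using P that by auto
      moreover from this have "x \<noteq> 0" using V by metis
      ultimately show ?thesis by simp
    qed
    then show "P \<in> Pow ?W" by blast
  qed auto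
  moreover have "F (V - P) = G (?N - card P) ((?W - P) \<inter> {1..?N - card P})" if "P \<in> Pow ?W" for P
  proof -
    have P: "P \<subseteq> V" "finite P" using that V finite_subset by auto
    then have "card (V - P) = ?N - card P" by (simp add: card_Diff_subset)
    moreover have "(V - P) \<inter> {1..?N - card P} = (?W - P) \<inter> {1..?N - card P}" by auto
    ultimately show ?thesis using assms V by (simp add: represents_def)
  qed
  ultimately show "stepP p F V = shape_stepP p G ?N ?W"
    unfolding stepP_def shape_stepP_def by (simp only: cong: sum.cong)
qed

lemma represents_stepE:
  assumes "represents F G"
  shows "represents (stepE q F) (shape_stepE q G)"
  unfolding represents_def
proof (intro allI impI)
  fix V :: "nat set" assume V: "finite V \<and> 0 \<notin> V"
  let ?N = "card V" and ?W = "V \<inter> {1..card V}"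
  let ?A = "\<lambda>e. {E. E \<subseteq> V - {1..Suc (?N - e)} \<and> card E = e}"
  have sub: "{E. E \<subseteq> V \<and> (\<forall>x\<in>E. x > Suc (?N - card E))} = (\<Union>e\<in>{..?N}. ?A e)"
  proof (intro Set.set_eqI iffI)
    fix E assume E: "E \<in> {E. E \<subseteq> V \<and> (\<forall>x\<in>E. x > Suc (?N - card E))}"
    then have "card E \<le> ?N" using V by (simp add: card_mono)
    moreover have "E \<in> ?A (card E)" using E by auto
    ultimately show "E \<in> (\<Union>e\<in>{..?N}. ?A e)" by blast
  next
    fix E assume "E \<in> (\<Union>e\<in>{..?N}. ?A e)"
    then have E: "E \<subseteq> V" "E \<subseteq> - {1..Suc (?N - card E)}" by auto
    have "x > Suc (?N - card E)" if "x \<in> E" for x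
    proof -
      have "x \<noteq> 0" using subsetD[OF E(1) that] V by metis
      moreover have "x \<notin> {1..Suc (?N - card E)}" using subsetD[OF E(2) that] by simp
      ultimately show ?thesis by simp
    qed
    then show "E \<in> {E. E \<subseteq> V \<and> (\<forall>x\<in>E. x > Suc (?N - card E))}" using E(1) by simp
  qed
  have fin: "finite (?A e)" for e using V by simp
  have "stepE q F V = (\<Sum>e\<le>?N. \<Sum>E\<in>?A e. q ^ card E * F (V - E))"
    unfolding stepE_def sub
  proof (rule sum.UNION_disjoint)
    show "\<forall>e\<in>{..?N}. finite (?A e)" using fin by blast
    show "\<forall>e\<in>{..?N}. \<forall>e'\<in>{..?N}. e \<noteq> e' \<longrightarrow> ?A e \<inter> ?A e' = {}" by blast
  qed simp
  also have "\<dots> = shape_stepE q G ?N ?W"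
    unfolding shape_stepE_def
  proof (rule sum.cong[OF refl])
    fix e assume e: "e \<in> {..?N}"
    have "(\<Sum>E\<in>?A e. q ^ card E * F (V - E)) = (\<Sum>E\<in>?A e. q ^ e * G (?N - e) (?W \<inter> {1..?N - e}))"
    proof (rule sum.cong[OF refl])
      fix E assume E: "E \<in> ?A e"
      then have "finite E" using V finite_subset by blast
      then have "card (V - E) = ?N - e" using E card_Diff_subset[of E V] by blast
      moreover have "(V - E) \<inter> {1..?N - e} = ?W \<inter> {1..?N - e}" using E by auto
      ultimately show "q ^ card E * F (V - E) = q ^ e * G (?N - e) (?W \<inter> {1..?N - e})"
        using assms V E by (simp add: represents_def)
    qed
    also have "\<dots> = of_nat (card (?A e)) * (q ^ e * G (?N - e) (?W \<inter> {1..?N - e}))" by simp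
    also have "card (?A e) = (card (V - {1..Suc (?N - e)})) choose e"
      using V by (intro n_subsets) auto
    also have "\<dots> = (?N - card (?W \<inter> {1..Suc (?N - e)})) choose e"
    \<comment> \<open>For \<open>e > 0\<close> the bound \<open>Suc (?N - e)\<close> is at most
      \<open>?N\<close>, so \<open>?W\<close> and \<open>V\<close> agree up to it; for
      \<open>e = 0\<close> both binomial coefficients are 1.\<close>
    proof (cases "e = 0")
      case False
      then have "?W \<inter> {1..Suc (?N - e)} = V \<inter> {1..Suc (?N - e)}" using e by auto
      then have "card (V - {1..Suc (?N - e)}) = ?N - card (?W \<inter> {1..Suc (?N - e)})"
        using card_Diff_subset_Int[of V "{1..Suc (?N - e)}"] V by simp
      then show ?thesis by (rule arg_cong)
    qed simp
    finally show "(\<Sum>E\<in>?A e. q ^ card E * F (V - E)) = q ^ e * of_nat ((?N - card (?W \<inter> {1..Suc (?N - e)})) choose e) *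
       G (?N - e) (?W \<inter> {1..?N - e})"
      by (simp only: mult_ac)
  qed
  finally show "stepE q F V = shape_stepE q G ?N ?W" .
qed

text \<open>Summing over all sets \<open>V\<close> of \<open>T\<close> values that consist of \<open>W \<subseteq> {1..T}\<close> and of the values
  \<open>T + 1, \<dots>, T + h\<close>.\<close>

definition open_sum :: "(nat \<Rightarrow> nat set \<Rightarrow> 'a::comm_ring_1) \<Rightarrow> nat \<Rightarrow> nat \<Rightarrow> 'a" where
  "open_sum G T h = (\<Sum>W | W \<subseteq> {1..T} \<and> card W + h = T. G T W)"

lemma sum_subsets_by_codegree:
  "(\<Sum>U | U \<subseteq> {1..T}. f (T - card U) * G T U) = (\<Sum>h\<le>T. f h * open_sum G T h)"
proof -
  have le: "card U \<le> T" if "U \<subseteq> {1..T}" for U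
    using card_mono[OF _ that] by simp
  have "(\<Sum>U | U \<subseteq> {1..T}. f (T - card U) * G T U) =
    (\<Sum>h\<le>T. \<Sum>U | U \<in> {U. U \<subseteq> {1..T}} \<and> T - card U = h. f (T - card U) * G T U)"
    by (rule sum.group[symmetric]) auto
  also have "\<dots> = (\<Sum>h\<le>T. \<Sum>U | U \<subseteq> {1..T} \<and> card U + h = T. f h * G T U)"
  proof (intro sum.cong refl)
    fix h assume "h \<in> {..T}"
    then show "{U. U \<in> {U. U \<subseteq> {1..T}} \<and> T - card U = h} = {U. U \<subseteq> {1..T} \<and> card U + h = T}"
      using le by fastforce
  qed auto
  finally show ?thesis by (simp add: open_sum_def sum_distrib_left)
qed

lemma card_subsets_add:
  assumes "finite B"
  shows "card {J. J \<subseteq> B \<and> card J + a = b} = (if a \<le> b then card B choose (b - a) else 0)"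
proof (cases "a \<le> b")
  case True
  then have "{J. J \<subseteq> B \<and> card J + a = b} = {J. J \<subseteq> B \<and> card J = b - a}" by auto
  then show ?thesis using True assms by (simp add: n_subsets)
qed auto

text \<open>With \<open>c = card P\<close>, the rest of \<open>W\<close> splits into
  \<open>U\<close>, the values up to \<open>N - c\<close>, and \<open>J\<close>, the values above.
  If \<open>U\<close> omits \<open>h\<close> of the values up to \<open>N - c\<close>, then
  \<open>card J = h - h'\<close>, which gives the first binomial coefficient; \<open>P\<close> is
  any \<open>c\<close>-subset of the \<open>h' + c\<close> values up to \<open>N\<close> outside
  \<open>U\<close> and \<open>J\<close>, which gives the second.\<close>

lemma open_sum_stepP:
  "open_sum (shape_stepP p G) N h' = (\<Sum>c\<le>N. \<Sum>h\<le>N - c.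
     (if h' \<le> h then p ^ c * of_nat ((c choose (h - h')) * ((h' + c) choose c)) else 0) * open_sum G (N - c) h)"
proof -
  let ?J = "\<lambda>c U. {J. J \<subseteq> {N - c<..N} \<and> card J + (card U + c + h') = N}"
  let ?P = "\<lambda>c U J. {P. P \<subseteq> {1..N} - (U \<union> J) \<and> card P = c}"
  have fin: "finite W" if "W \<subseteq> {1..N}" for W using that finite_subset by blast
  have "open_sum (shape_stepP p G) N h' = (\<Sum>(W, P)\<in>(SIGMA W:{W. W \<subseteq> {1..N} \<and> card W + h' = N}. Pow W).
      p ^ card P * G (N - card P) ((W - P) \<inter> {1..N - card P}))"
    unfolding open_sum_def shape_stepP_def using fin by (subst sum.Sigma) auto
  also have "\<dots> = (\<Sum>(c, U, J, P)\<in>(SIGMA c:{..N}. SIGMA U:{U. U \<subseteq> {1..N - c}}. SIGMA J:?J c U. ?P c U J).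
      p ^ c * G (N - c) U)"
  proof (rule sum.reindex_bij_witness[where
        i = "\<lambda>(c, U, J, P). (U \<union> J \<union> P, P)" and
        j = "\<lambda>(W, P). (card P, (W - P) \<inter> {1..N - card P}, (W - P) \<inter> {N - card P<..N}, P)"], goal_cases)
    case (1 a)
    then obtain W P where a: "a = (W, P)" "W \<subseteq> {1..N}" "P \<subseteq> W" by auto
    then have "(W - P) \<inter> {1..N - card P} \<union> (W - P) \<inter> {N - card P<..N} \<union> P = W" by fastforce
    with a show ?case by simp
  next
    case (2 a)
    then obtain W P where a: "a = (W, P)" "W \<subseteq> {1..N}" "card W + h' = N" "P \<subseteq> W" by auto
    have fW: "finite W" "finite P" using a fin by auto
    let ?U = "(W - P) \<inter> {1..N - card P}" and ?K = "(W - P) \<inter> {N - card P<..N}"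
    have "W = (?U \<union> ?K) \<union> P" using a by fastforce
    moreover have "card (?U \<union> ?K \<union> P) = card (?U \<union> ?K) + card P"
      by (rule card_Un_disjoint) (use fW in auto)
    moreover have "card (?U \<union> ?K) = card ?U + card ?K"
      by (rule card_Un_disjoint) (use fW in auto)
    ultimately have "card W = card ?U + card ?K + card P" by simp
    with a show ?case by auto
  next
    case (3 b)
    then obtain c U J P where b: "b = (c, U, J, P)" "c \<le> N" "U \<subseteq> {1..N - c}" "J \<subseteq> {N - c<..N}"
       "P \<subseteq> {1..N} - (U \<union> J)" "card P = c" by auto
    then have "(U \<union> J \<union> P - P) \<inter> {1..N - c} = U" "(U \<union> J \<union> P - P) \<inter> {N - c<..N} = J" by fastforce+
    with b show ?case by simp
  next
    case (4 b)
    then obtain c U J P where b: "b = (c, U, J, P)" "c \<le> N" "U \<subseteq> {1..N - c}" "J \<subseteq> {N - c<..N}"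
       "P \<subseteq> {1..N} - (U \<union> J)" "card P = c" "card J + (card U + c + h') = N" by auto
    then have s: "U \<subseteq> {1..N}" "J \<subseteq> {1..N}" "P \<subseteq> {1..N}" by fastforce+
    note f = fin[OF s(1)] fin[OF s(2)] fin[OF s(3)]
    have "card (U \<union> J \<union> P) = card (U \<union> J) + card P"
      by (rule card_Un_disjoint) (use f b(5) in auto)
    moreover have "card (U \<union> J) = card U + card J"
      by (rule card_Un_disjoint) (use f b(3,4) in fastforce)+
    ultimately show ?case using b s by auto
  next
    case (5 a)
    then show ?case by auto
  qed
  also have "\<dots> = (\<Sum>c\<le>N. \<Sum>U | U \<subseteq> {1..N - c}. \<Sum>J\<in>?J c U. \<Sum>P\<in>?P c U J. p ^ c * G (N - c) U)"
  proof (subst sum.Sigma[symmetric]; (intro sum.cong refl)?)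
    fix c
    show "(\<Sum>(U, J, P)\<in>(SIGMA U:{U. U \<subseteq> {1..N - c}}. SIGMA J:?J c U. ?P c U J). p ^ c * G (N - c) U) =
      (\<Sum>U | U \<subseteq> {1..N - c}. \<Sum>J\<in>?J c U. \<Sum>P\<in>?P c U J. p ^ c * G (N - c) U)"
    proof (subst sum.Sigma[symmetric]; (intro sum.cong refl)?)
      fix U
      show "(\<Sum>(J, P)\<in>(SIGMA J:?J c U. ?P c U J). p ^ c * G (N - c) U) =
        (\<Sum>J\<in>?J c U. \<Sum>P\<in>?P c U J. p ^ c * G (N - c) U)"
        by (rule sum.Sigma[symmetric]) auto
    qed auto
  qed auto
  also have "\<dots> = (\<Sum>c\<le>N. \<Sum>U | U \<subseteq> {1..N - c}.
     (if h' \<le> N - c - card U then p ^ c * of_nat ((c choose (N - c - card U - h')) * ((h' + c) choose c)) else 0) * G (N - c) U)"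
  proof (intro sum.cong refl)
    fix c U assume c: "c \<in> {..N}" and U: "U \<in> {U. U \<subseteq> {1..N - c}}"
    have comm: "card U + c + h' = c + card U + h'" by simp
    have Uc: "card U \<le> N - c" using U card_mono[of "{1..N - c}" U] by simp
    have fU: "finite U" using U finite_subset by auto
    have "card (?P c U J) = (h' + c) choose c" if J: "J \<in> ?J c U" for J
    proof -
      have fJ: "finite J" using J finite_subset by auto
      have "card (U \<union> J) = card U + card J"
        by (rule card_Un_disjoint) (use fU fJ in blast, use fU fJ in blast, use U J in fastforce)
      moreover have "U \<union> J \<subseteq> {1..N}" using U J by fastforce
      ultimately have "card ({1..N} - (U \<union> J)) = h' + c"
        using J fU fJ by (auto simp: card_Diff_subset)
      then show ?thesis by (subst n_subsets) auto
    qed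
    then have "(\<Sum>J\<in>?J c U. \<Sum>P\<in>?P c U J. p ^ c * G (N - c) U) =
      (\<Sum>J\<in>?J c U. of_nat ((h' + c) choose c) * (p ^ c * G (N - c) U))"
      by (intro sum.cong) simp_all
    also have "\<dots> = of_nat (card (?J c U)) * (of_nat ((h' + c) choose c) * (p ^ c * G (N - c) U))"
      by simp
    also have "card (?J c U) = (if h' \<le> N - c - card U then c choose (N - c - card U - h') else 0)"
      using c Uc by (subst card_subsets_add) (auto simp: comm)
    finally show "(\<Sum>J\<in>?J c U. \<Sum>P\<in>?P c U J. p ^ c * G (N - c) U) =
     (if h' \<le> N - c - card U then p ^ c * of_nat ((c choose (N - c - card U - h')) * ((h' + c) choose c)) else 0) * G (N - c) U"
      by (simp add: mult_ac)
  qed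
  also have "\<dots> = (\<Sum>c\<le>N. \<Sum>h\<le>N - c.
     (if h' \<le> h then p ^ c * of_nat ((c choose (h - h')) * ((h' + c) choose c)) else 0) * open_sum G (N - c) h)"
    by (intro sum.cong refl sum_subsets_by_codegree)
  finally show ?thesis .
qed

text \<open>The number of ways to add \<open>e\<close> excedances when the number of open positions grows from \<open>h\<close>
  to \<open>h + i\<close>.\<close>

fun exc_kernel :: "nat \<Rightarrow> nat \<Rightarrow> nat \<Rightarrow> nat" where
  "exc_kernel 0 h i = of_bool (i = 0)"
| "exc_kernel (Suc e) h i = (e choose i) * ((e + h) choose Suc e) +
     (case i of 0 \<Rightarrow> 0 | Suc i' \<Rightarrow> (e choose i') * ((Suc e + h) choose Suc e))"

text \<open>Pascal's rule. For generating functions in \<open>e\<close> it expresses the kernel as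
  \<open>1 - c X\<close> times the series of the products
  \<open>(e choose i) * ((h + e) choose e)\<close>.\<close>

lemma exc_kernel_Suc:
  "exc_kernel (Suc e) h i + (e choose i) * ((h + e) choose e) =
     (Suc e choose i) * ((h + Suc e) choose Suc e)"
  by (cases i) (simp_all add: algebra_simps)

lemma sum_subsets_insert:
  assumes "finite B" "b \<notin> B"
  shows "(\<Sum>J | J \<subseteq> insert b B \<and> card J = m. f J) =
    (\<Sum>J | J \<subseteq> B \<and> card J = m. f J) + (\<Sum>J | J \<subseteq> B \<and> Suc (card J) = m. f (insert b J))"
proof -
  have fin: "finite J" if "J \<subseteq> B" for J using that assms finite_subset by blast
  have inj: "inj_on (insert b) {J. J \<subseteq> B \<and> Suc (card J) = m}"
    using assms(2) by (auto intro!: inj_onI)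
  have "{J. J \<subseteq> insert b B \<and> card J = m} =
    {J. J \<subseteq> B \<and> card J = m} \<union> insert b ` {J. J \<subseteq> B \<and> Suc (card J) = m}"
  proof (intro Set.set_eqI iffI)
    fix J assume J: "J \<in> {J. J \<subseteq> insert b B \<and> card J = m}"
    show "J \<in> {J. J \<subseteq> B \<and> card J = m} \<union> insert b ` {J. J \<subseteq> B \<and> Suc (card J) = m}"
    proof (cases "b \<in> J")
      case True
      have "finite J" using J assms(1) finite_subset[of J "insert b B"] by simp
      then have "Suc (card (J - {b})) = card J" using True by (rule card_Suc_Diff1)
      then have "J - {b} \<in> {J. J \<subseteq> B \<and> Suc (card J) = m}" using J by auto
      moreover have "J = insert b (J - {b})" using True by auto
      ultimately show ?thesis by blast
    next
      case False
      with J show ?thesis by auto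
    qed
  next
    fix J assume "J \<in> {J. J \<subseteq> B \<and> card J = m} \<union> insert b ` {J. J \<subseteq> B \<and> Suc (card J) = m}"
    then consider "J \<subseteq> B" "card J = m" | J' where "J = insert b J'" "J' \<subseteq> B" "Suc (card J') = m"
      by blast
    then show "J \<in> {J. J \<subseteq> insert b B \<and> card J = m}"
    proof cases
      case 1
      then show ?thesis by auto
    next
      case (2 J')
      then have "b \<notin> J'" "finite J'" using assms(2) fin by auto
      with 2 show ?thesis by auto
    qed
  qed
  then have "(\<Sum>J | J \<subseteq> insert b B \<and> card J = m. f J) =
    (\<Sum>J\<in>{J. J \<subseteq> B \<and> card J = m}. f J) + (\<Sum>J\<in>insert b ` {J. J \<subseteq> B \<and> Suc (card J) = m}. f J)"
    using assms by (simp only:) (rule sum.union_disjoint; auto)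
  then show ?thesis by (simp add: sum.reindex[OF inj])
qed

text \<open>The value \<open>Suc (N - e)\<close> is the first position of the new part, hence not an
  excedance there; its presence in \<open>J\<close> lowers the number of candidates by one.
  Splitting by this membership yields the two summands of \<open>exc_kernel\<close>.\<close>

lemma sum_exc_kernel:
  assumes "e \<le> N"
  shows "(\<Sum>J | J \<subseteq> {N - e<..N} \<and> card J + h' = e + h. (e + h - of_bool (Suc (N - e) \<in> J)) choose e) =
    (if h \<le> h' then exc_kernel e h (h' - h) else 0)"
proof (cases e)
  case 0
  have "{J. J \<subseteq> {N - e<..N} \<and> card J + h' = e + h} = (if h' = h then {{}} else {})"
    using 0 by auto
  with 0 show ?thesis by auto
next
  case (Suc d)
  let ?b = "Suc (N - e)" and ?B = "{Suc (N - e)<..N}"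
  have ins: "{N - e<..N} = insert ?b ?B" using assms Suc by auto
  have cB: "card ?B = d" using assms Suc by simp
  show ?thesis
  proof (cases "h' \<le> e + h")
    case True
    define m where "m = e + h - h'"
    have "{J. J \<subseteq> {N - e<..N} \<and> card J + h' = e + h} = {J. J \<subseteq> insert ?b ?B \<and> card J = m}"
      unfolding ins m_def using True by auto
    then have "(\<Sum>J | J \<subseteq> {N - e<..N} \<and> card J + h' = e + h. (e + h - of_bool (?b \<in> J)) choose e) =
      (\<Sum>J | J \<subseteq> insert ?b ?B \<and> card J = m. (e + h - of_bool (?b \<in> J)) choose e)" by simp
    also have "\<dots> = (\<Sum>J | J \<subseteq> ?B \<and> card J = m. (e + h - of_bool (?b \<in> J)) choose e) +
      (\<Sum>J | J \<subseteq> ?B \<and> Suc (card J) = m. (e + h - of_bool (?b \<in> insert ?b J)) choose e)"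
      by (rule sum_subsets_insert) auto
    also have "(\<Sum>J | J \<subseteq> ?B \<and> card J = m. (e + h - of_bool (?b \<in> J)) choose e) =
      (\<Sum>J | J \<subseteq> ?B \<and> card J = m. (e + h) choose e)"
      by (rule sum.cong) auto
    also have "\<dots> = (d choose m) * ((e + h) choose e)"
      by (simp only: sum_constant n_subsets[OF finite_greaterThanAtMost] cB of_nat_id)
    also have "(\<Sum>J | J \<subseteq> ?B \<and> Suc (card J) = m. (e + h - of_bool (?b \<in> insert ?b J)) choose e) =
      card {J. J \<subseteq> ?B \<and> card J + 1 = m} * ((e + h - 1) choose e)"
      by simp
    also have "card {J. J \<subseteq> ?B \<and> card J + 1 = m} = (if 1 \<le> m then d choose (m - 1) else 0)"
      by (simp only: card_subsets_add[OF finite_greaterThanAtMost] cB)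
    also have "(d choose m) * ((e + h) choose e) + (if 1 \<le> m then d choose (m - 1) else 0) * ((e + h - 1) choose e)
      = (if h \<le> h' then exc_kernel e h (h' - h) else 0)"
    proof (cases "h \<le> h'")
      case False
      then show ?thesis using Suc m_def by (simp add: binomial_eq_0)
    next
      case le: True
      define i where "i = h' - h"
      have i: "i \<le> Suc d" "m = Suc d - i" using True le Suc by (auto simp: i_def m_def)
      \<comment> \<open>As \<open>m = Suc d - i\<close>, this and the next conversion pass to
        complements in a set of \<open>d\<close> elements; the term vanishes for
        \<open>i = 0\<close> because then \<open>m > d\<close>.\<close>
      have "d choose m = (case i of 0 \<Rightarrow> 0 | Suc i' \<Rightarrow> d choose i')"
      proof (cases i)
        case 0
        then show ?thesis using i by (simp add: binomial_eq_0)
      next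
        case (Suc i')
        then show ?thesis using i binomial_symmetric[of i' d] by simp
      qed
      moreover have "(if 1 \<le> m then d choose (m - 1) else 0) = d choose i"
      proof (cases "i \<le> d")
        case True
        then show ?thesis using i binomial_symmetric[of i d] by (simp add: Suc_diff_le)
      next
        case False
        then show ?thesis using i by (simp add: binomial_eq_0)
      qed
      ultimately show ?thesis using le Suc by (cases i) (simp_all add: i_def[symmetric])
    qed
    finally show ?thesis .
  next
    case False
    then have "{J. J \<subseteq> {N - e<..N} \<and> card J + h' = e + h} = {}" by auto
    moreover have "exc_kernel e h (h' - h) = 0"
      using False Suc by (auto simp: binomial_eq_0 split: nat.split)
    ultimately show ?thesis by (simp only: sum.empty if_cancel)
  qed
qed

text \<open>For fixed \<open>e\<close>, cut \<open>W\<close> at \<open>N - e\<close> into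
  \<open>U\<close> and \<open>J\<close>. The binomial coefficient sees \<open>U\<close> only through
  its size and \<open>J\<close> only through the membership of \<open>Suc (N - e)\<close>, so
  \<open>sum_exc_kernel\<close> evaluates the sum over \<open>J\<close>.\<close>

lemma open_sum_stepE:
  "open_sum (shape_stepE q G) N h' = (\<Sum>e\<le>N. \<Sum>h\<le>N - e.
     (if h \<le> h' then q ^ e * of_nat (exc_kernel e h (h' - h)) else 0) * open_sum G (N - e) h)"
proof -
  let ?J = "\<lambda>e U. {J. J \<subseteq> {N - e<..N} \<and> card J + (card U + h') = N}"
  have "open_sum (shape_stepE q G) N h' = (\<Sum>e\<le>N. \<Sum>W | W \<subseteq> {1..N} \<and> card W + h' = N.
      q ^ e * of_nat ((N - card (W \<inter> {1..Suc (N - e)})) choose e) * G (N - e) (W \<inter> {1..N - e}))"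
    unfolding open_sum_def shape_stepE_def by (rule sum.swap)
  also have "\<dots> = (\<Sum>e\<le>N. \<Sum>U | U \<subseteq> {1..N - e}. (if N - e - card U \<le> h' then q ^ e *
      of_nat (exc_kernel e (N - e - card U) (h' - (N - e - card U))) else 0) * G (N - e) U)"
  proof (rule sum.cong[OF refl])
    fix e assume "e \<in> {..N}"
    then have e: "e \<le> N" by simp
    have "(\<Sum>W | W \<subseteq> {1..N} \<and> card W + h' = N.
        q ^ e * of_nat ((N - card (W \<inter> {1..Suc (N - e)})) choose e) * G (N - e) (W \<inter> {1..N - e})) =
      (\<Sum>(U, J)\<in>(SIGMA U:{U. U \<subseteq> {1..N - e}}. ?J e U).
        q ^ e * of_nat ((N - card U - of_bool (Suc (N - e) \<in> J)) choose e) * G (N - e) U)"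
    proof (rule sum.reindex_bij_witness[where
          i = "\<lambda>(U, J). U \<union> J" and j = "\<lambda>W. (W \<inter> {1..N - e}, W \<inter> {N - e<..N})"], goal_cases)
      case (1 W)
      then have "W \<inter> {1..N - e} \<union> W \<inter> {N - e<..N} = W" by fastforce
      then show ?case by simp
    next
      case (2 W)
      then have W: "W \<subseteq> {1..N}" "card W + h' = N" "finite W" using finite_subset by auto
      have "W \<inter> {1..N - e} \<union> W \<inter> {N - e<..N} = W" using W(1) by fastforce
      moreover have "card (W \<inter> {1..N - e} \<union> W \<inter> {N - e<..N}) = card (W \<inter> {1..N - e}) + card (W \<inter> {N - e<..N})"
        by (rule card_Un_disjoint) (use W(3) in auto)
      ultimately show ?case using W(2) by auto
    next
      case (3 b)
      then obtain U J where b: "b = (U, J)" "U \<subseteq> {1..N - e}" "J \<subseteq> {N - e<..N}" by auto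
      then have "(U \<union> J) \<inter> {1..N - e} = U" "(U \<union> J) \<inter> {N - e<..N} = J" by fastforce+
      with b(1) show ?case by simp
    next
      case (4 b)
      then obtain U J where b: "b = (U, J)" "U \<subseteq> {1..N - e}" "J \<subseteq> {N - e<..N}"
        "card J + (card U + h') = N" by auto
      have f: "finite U" "finite J" using b(2,3) finite_subset by auto
      have "card (U \<union> J) = card U + card J"
        by (rule card_Un_disjoint) (use f b(2,3) in fastforce)+
      moreover have "U \<union> J \<subseteq> {1..N}" using b(2,3) by fastforce
      ultimately show ?case using b(1,4) by auto
    next
      case (5 W)
      then have W: "W \<subseteq> {1..N}" "finite W" using finite_subset by auto
      have "card (W \<inter> {1..Suc (N - e)}) = card (W \<inter> {1..N - e}) + of_bool (Suc (N - e) \<in> W \<inter> {N - e<..N})"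
      proof (cases "Suc (N - e) \<in> W")
        case True
        then have "W \<inter> {1..Suc (N - e)} = insert (Suc (N - e)) (W \<inter> {1..N - e})" by auto
        moreover have "Suc (N - e) \<in> {N - e<..N}" using True W(1) by auto
        ultimately show ?thesis using True W(2) by simp
      next
        case False
        then have "W \<inter> {1..Suc (N - e)} = W \<inter> {1..N - e}" by (auto simp: le_Suc_eq)
        then show ?thesis using False by simp
      qed
      then show ?case by (simp only: prod.case diff_diff_left)
    qed
    also have "\<dots> = (\<Sum>U | U \<subseteq> {1..N - e}. \<Sum>J\<in>?J e U.
        q ^ e * of_nat ((N - card U - of_bool (Suc (N - e) \<in> J)) choose e) * G (N - e) U)"
      by (rule sum.Sigma[symmetric]) auto
    also have "\<dots> = (\<Sum>U | U \<subseteq> {1..N - e}. (if N - e - card U \<le> h' then q ^ e *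
        of_nat (exc_kernel e (N - e - card U) (h' - (N - e - card U))) else 0) * G (N - e) U)"
    proof (rule sum.cong[OF refl])
      fix U assume U: "U \<in> {U. U \<subseteq> {1..N - e}}"
      define h where "h = N - e - card U"
      have "card U \<le> N - e" using U card_mono[of "{1..N - e}" U] by simp
      then have h: "N - card U = e + h" "N = e + h + card U" using e by (auto simp: h_def)
      have J: "?J e U = {J. J \<subseteq> {N - e<..N} \<and> card J + h' = e + h}"
        using h(2) by auto
      have "(\<Sum>J\<in>?J e U. q ^ e * of_nat ((N - card U - of_bool (Suc (N - e) \<in> J)) choose e) * G (N - e) U) =
        q ^ e * of_nat (\<Sum>J\<in>?J e U. (N - card U - of_bool (Suc (N - e) \<in> J)) choose e) * G (N - e) U"
        by (simp only: of_nat_sum sum_distrib_left sum_distrib_right)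
      also have "(\<Sum>J\<in>?J e U. (N - card U - of_bool (Suc (N - e) \<in> J)) choose e) =
        (if h \<le> h' then exc_kernel e h (h' - h) else 0)"
        unfolding J h(1) by (rule sum_exc_kernel[OF e])
      finally show "(\<Sum>J\<in>?J e U. q ^ e * of_nat ((N - card U - of_bool (Suc (N - e) \<in> J)) choose e) * G (N - e) U) =
        (if N - e - card U \<le> h' then q ^ e * of_nat (exc_kernel e (N - e - card U) (h' - (N - e - card U))) else 0) * G (N - e) U"
        unfolding h_def[symmetric] by simp
    qed
    finally show "(\<Sum>W | W \<subseteq> {1..N} \<and> card W + h' = N.
        q ^ e * of_nat ((N - card (W \<inter> {1..Suc (N - e)})) choose e) * G (N - e) (W \<inter> {1..N - e})) =
      (\<Sum>U | U \<subseteq> {1..N - e}. (if N - e - card U \<le> h' then q ^ e *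
        of_nat (exc_kernel e (N - e - card U) (h' - (N - e - card U))) else 0) * G (N - e) U)" .
  qed
  also have "\<dots> = (\<Sum>e\<le>N. \<Sum>h\<le>N - e.
     (if h \<le> h' then q ^ e * of_nat (exc_kernel e h (h' - h)) else 0) * open_sum G (N - e) h)"
    by (intro sum.cong refl sum_subsets_by_codegree)
  finally show ?thesis .
qed

section \<open>Generating functions\<close>

definition open_gf :: "(nat \<Rightarrow> nat set \<Rightarrow> 'a::comm_ring_1) \<Rightarrow> nat \<Rightarrow> 'a fps" where
  "open_gf G h = Abs_fps (\<lambda>T. open_sum G T h)"

lemma open_sum_eq_0: "T < h \<Longrightarrow> open_sum G T h = 0"
  unfolding open_sum_def by (rule sum.neutral) auto

lemma sum_open_sum_extend:
  assumes "T \<le> M"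
  shows "(\<Sum>h\<le>T. f h * open_sum G T h) = (\<Sum>h\<le>M. f h * open_sum G T h)"
  using assms by (intro sum.mono_neutral_left) (auto simp: open_sum_eq_0)

text \<open>\<open>open_sum G T h\<close> vanishes for \<open>h > T\<close>, so the sum over
  \<open>h\<close> may run to any common bound \<open>M \<ge> N\<close>. Comparing one coefficient
  at a time thus keeps a formally infinite sum of series finite.\<close>

lemma open_gf_kernel:
  fixes G :: "nat \<Rightarrow> nat set \<Rightarrow> 'a::comm_ring_1"
  assumes "\<And>N. open_sum G' N h' = (\<Sum>c\<le>N. \<Sum>h\<le>N - c. K h c * open_sum G (N - c) h)"
    and "N \<le> M"
  shows "fps_nth (open_gf G' h') N = (\<Sum>h\<le>M. fps_nth (Abs_fps (K h) * open_gf G h) N)"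
proof -
  have "fps_nth (open_gf G' h') N = (\<Sum>c\<le>N. \<Sum>h\<le>M. K h c * open_sum G (N - c) h)"
    unfolding open_gf_def fps_nth_Abs_fps assms(1)
    using assms(2) by (intro sum.cong refl sum_open_sum_extend) auto
  also have "\<dots> = (\<Sum>h\<le>M. \<Sum>c\<le>N. K h c * open_sum G (N - c) h)" by (rule sum.swap)
  finally show ?thesis by (simp add: open_gf_def fps_mult_nth atLeast0AtMost)
qed

section \<open>Generating functions of the transfer coefficients\<close>

text \<open>Both sides equal \<open>(h + e)! / (h! i! (e - i)!)\<close>. The right-hand form has a
  single factor depending on \<open>e\<close>, a coefficient of a negative binomial series.\<close>

lemma choose_mult_shift:
  assumes "i \<le> e"
  shows "(e choose i) * ((h + e) choose e) = ((h + i) choose h) * ((h + e) choose (e - i))"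
proof -
  have "((h + e) choose e) * (e choose i) = ((h + e) choose i) * ((h + e - i) choose (e - i))"
    using assms by (intro choose_mult) auto
  moreover have "((h + e) choose (h + i)) * ((h + i) choose i) = ((h + e) choose i) * ((h + e - i) choose h)"
    using assms choose_mult[of i "h + i" "h + e"] by simp
  moreover have "(h + e - i) choose (e - i) = (h + e - i) choose h"
    using assms binomial_symmetric[of h "h + e - i"] by simp
  moreover have "(h + e) choose (e - i) = (h + e) choose (h + i)"
    using assms binomial_symmetric[of "h + i" "h + e"] by simp
  moreover have "(h + i) choose i = (h + i) choose h"
    using binomial_symmetric[of i "h + i"] by simp
  ultimately show ?thesis by (simp only: mult.commute)
qed

context
  fixes c :: "'a::field_char_0"
begin

lemma choose_product_gf:
  "Abs_fps (\<lambda>e. c ^ e * of_nat ((e choose i) * ((h + e) choose e))) =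
    of_nat ((h + i) choose h) * (fps_const c * fps_X) ^ i * inverse (1 - fps_const c * fps_X) ^ Suc (h + i)"
proof (rule fps_ext)
  fix e
  have "fps_nth (of_nat ((h + i) choose h) * (fps_const c * fps_X) ^ i * inverse (1 - fps_const c * fps_X) ^ Suc (h + i)) e
     = of_nat ((h + i) choose h) * (c ^ i * fps_nth (fps_X ^ i * inverse ((1 - fps_const c * fps_X) ^ Suc (h + i))) e)"
    by (simp only: power_mult_distrib fps_const_power fps_of_nat[symmetric] mult.assoc fps_mult_left_const_nth fps_inverse_power)
  also have "\<dots> = (if e < i then 0 else of_nat ((h + i) choose h) * (c ^ i * (of_nat ((h + e) choose (e - i)) * c ^ (e - i))))"
    by (subst one_minus_const_fps_X_neg_power') (auto simp: fps_X_power_mult_nth add.assoc)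
  also have "\<dots> = c ^ e * of_nat ((e choose i) * ((h + e) choose e))"
  proof (cases "e < i")
    case False
    then have "c ^ i * c ^ (e - i) = c ^ e" by (simp flip: power_add)
    then show ?thesis using False choose_mult_shift[of i e h]
      by (simp add: mult_ac)
  qed (simp add: binomial_eq_0)
  finally show "fps_nth (Abs_fps (\<lambda>e. c ^ e * of_nat ((e choose i) * ((h + e) choose e)))) e =
    fps_nth (of_nat ((h + i) choose h) * (fps_const c * fps_X) ^ i * inverse (1 - fps_const c * fps_X) ^ Suc (h + i)) e"
    by simp
qed

lemma exc_kernel_gf:
  "Abs_fps (\<lambda>e. c ^ e * of_nat (exc_kernel e h i)) = (1 - fps_const c * fps_X) *
    (of_nat ((h + i) choose h) * (fps_const c * fps_X) ^ i * inverse (1 - fps_const c * fps_X) ^ Suc (h + i))"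
  unfolding choose_product_gf[symmetric]
proof (rule fps_ext)
  fix e
  show "fps_nth (Abs_fps (\<lambda>e. c ^ e * of_nat (exc_kernel e h i))) e =
    fps_nth ((1 - fps_const c * fps_X) * Abs_fps (\<lambda>e. c ^ e * of_nat ((e choose i) * ((h + e) choose e)))) e"
  proof (cases e)
    case 0
    then show ?thesis by (cases i) simp_all
  next
    case (Suc d)
    have "of_nat (exc_kernel (Suc d) h i) + of_nat ((d choose i) * ((h + d) choose d)) =
      (of_nat ((Suc d choose i) * ((h + Suc d) choose Suc d)) :: 'a)"
      unfolding of_nat_add[symmetric] exc_kernel_Suc ..
    then have "of_nat (exc_kernel (Suc d) h i) =
      (of_nat ((Suc d choose i) * ((h + Suc d) choose Suc d)) - of_nat ((d choose i) * ((h + d) choose d)) :: 'a)"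
      by (simp only: eq_diff_eq)
    then show ?thesis
      unfolding Suc left_diff_distrib mult_1 fps_sub_nth mult.assoc fps_mult_left_const_nth fps_X_mult_nth
        fps_nth_Abs_fps
      by (simp only: diff_Suc_1 nat.simps if_False power_Suc right_diff_distrib mult.assoc)
  qed
qed

end

text \<open>Passing \<open>E\<close> never lowers the number of open positions, so only
  \<open>j \<le> h\<close> contribute, and the binomial theorem sums
  \<open>C ^ j * (D * y) ^ (h - j)\<close> with coefficients \<open>h choose j\<close> to
  \<open>(C + D * y) ^ h\<close>.\<close>

lemma open_gf_stepE:
  fixes q :: "'a::field_char_0"
  assumes open_gf: "\<And>h. open_gf G h = lam * C ^ h * inverse D ^ Suc h" and D: "fps_nth D 0 \<noteq> 0"
  defines "y \<equiv> fps_const q * fps_X"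
  shows "open_gf (shape_stepE q G) h = lam * (1 - y) * (C + D * y) ^ h * inverse (D * (1 - y)) ^ Suc h"
proof (rule fps_ext)
  fix N
  define I where "I = inverse D"
  define J where "J = inverse (1 - y)"
  have DI: "D * I = 1" unfolding I_def by (rule inverse_mult_eq_1'[OF D])
  let ?K = "\<lambda>j e. if j \<le> h then q ^ e * of_nat (exc_kernel e j (h - j)) else 0"
  have K: "Abs_fps (?K j) = (if j \<le> h then (1 - y) * (of_nat (h choose j) * y ^ (h - j) * J ^ Suc h) else 0)" for j
  proof (cases "j \<le> h")
    case True
    then have "Abs_fps (?K j) = Abs_fps (\<lambda>e. q ^ e * of_nat (exc_kernel e j (h - j)))" by simp
    then show ?thesis using True unfolding exc_kernel_gf y_def J_def by simp
  qed (simp add: fps_eq_iff)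
  have "fps_nth (open_gf (shape_stepE q G) h) N = (\<Sum>j\<le>N + h. fps_nth (Abs_fps (?K j) * open_gf G j) N)"
    by (rule open_gf_kernel[OF open_sum_stepE]) simp
  also have "\<dots> = fps_nth (\<Sum>j\<le>N + h. Abs_fps (?K j) * open_gf G j) N"
    by (simp only: fps_sum_nth)
  also have "(\<Sum>j\<le>N + h. Abs_fps (?K j) * open_gf G j) = (\<Sum>j\<le>h. Abs_fps (?K j) * open_gf G j)"
  proof (rule sum.mono_neutral_right)
    show "\<forall>j\<in>{..N + h} - {..h}. Abs_fps (?K j) * open_gf G j = 0"
      unfolding K by simp
  qed auto
  also have "\<dots> = (\<Sum>j\<le>h. lam * (1 - y) * (I * J) ^ Suc h * (of_nat (h choose j) * C ^ j * (D * y) ^ (h - j)))"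
  proof (rule sum.cong[OF refl])
    fix j assume "j \<in> {..h}"
    then have j: "j \<le> h" by simp
    then have "I ^ Suc h = I ^ Suc j * I ^ (h - j)" by (simp flip: power_add)
    moreover have "D ^ (h - j) * I ^ (h - j) = 1" by (simp only: power_mult_distrib[symmetric] DI power_one)
    ultimately have "I ^ Suc h * D ^ (h - j) = I ^ Suc j" by (simp only: mult.assoc mult.commute) simp
    \<comment> \<open>Brings all terms to the common denominator \<open>D ^ Suc h\<close>.\<close>
    then have e: "I ^ Suc j = D ^ (h - j) * I ^ Suc h" by (simp only: mult.commute)
    show "Abs_fps (?K j) * open_gf G j = lam * (1 - y) * (I * J) ^ Suc h * (of_nat (h choose j) * C ^ j * (D * y) ^ (h - j))"
      unfolding K open_gf I_def[symmetric] e using j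
      by (simp only: if_True power_mult_distrib mult_ac)
  qed
  also have "\<dots> = lam * (1 - y) * (I * J) ^ Suc h * (C + D * y) ^ h"
    by (simp only: binomial_ring sum_distrib_left)
  also have "\<dots> = lam * (1 - y) * (C + D * y) ^ h * inverse (D * (1 - y)) ^ Suc h"
    unfolding I_def J_def by (simp only: fps_inverse_mult mult_ac)
  finally show "fps_nth (open_gf (shape_stepE q G) h) N =
    fps_nth (lam * (1 - y) * (C + D * y) ^ h * inverse (D * (1 - y)) ^ Suc h) N" .
qed

text \<open>Negative binomial series composed with \<open>z\<close>; stopping at \<open>N\<close> is
  exact for this coefficient since \<open>z ^ j\<close> has no term of degree below
  \<open>j\<close>.\<close>

lemma inverse_one_minus_power_nth:
  fixes A z :: "'a::field_char_0 fps"
  assumes z: "fps_nth z 0 = 0"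
  shows "fps_nth (A * inverse (1 - z) ^ Suc m) N = (\<Sum>j\<le>N. fps_nth (A * (of_nat ((m + j) choose m) * z ^ j)) N)"
proof -
  let ?B = "Abs_fps (\<lambda>k. of_nat ((m + k) choose m)) :: 'a fps"
  have "(m + k) choose k = (m + k) choose m" for k
    using binomial_symmetric[of k "m + k"] by simp
  then have "inverse ((1 - fps_X) ^ Suc m) = ?B"
    using one_minus_const_fps_X_neg_power'[of "Suc m" "1::'a"] by simp
  then have "?B oo z = inverse ((1 - fps_X) ^ Suc m) oo z" by simp
  also have "\<dots> = inverse ((1 - fps_X) ^ Suc m oo z)"
    using z by (intro fps_inverse_compose) (simp_all del: power_Suc)
  also have "(1 - fps_X) ^ Suc m oo z = (1 - z) ^ Suc m"
    using z by (simp add: fps_compose_power[symmetric] fps_compose_sub_distrib del: power_Suc)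
  finally have B: "inverse (1 - z) ^ Suc m = ?B oo z" by (simp only: fps_inverse_power)
  have nth: "fps_nth (?B oo z) l = (\<Sum>j\<le>N. of_nat ((m + j) choose m) * fps_nth (z ^ j) l)" if "l \<le> N" for l
    unfolding fps_compose_nth fps_nth_Abs_fps atLeast0AtMost
    using that z by (intro sum.mono_neutral_left) (auto simp: startsby_zero_power_prefix)
  have "fps_nth (A * (?B oo z)) N = (\<Sum>i=0..N. \<Sum>j\<le>N. fps_nth A i * (of_nat ((m + j) choose m) * fps_nth (z ^ j) (N - i)))"
    unfolding fps_mult_nth by (simp add: nth sum_distrib_left)
  also have "\<dots> = (\<Sum>j\<le>N. \<Sum>i=0..N. fps_nth A i * (of_nat ((m + j) choose m) * fps_nth (z ^ j) (N - i)))"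
    by (rule sum.swap)
  also have "\<dots> = (\<Sum>j\<le>N. fps_nth (A * (of_nat ((m + j) choose m) * z ^ j)) N)"
    by (simp add: fps_mult_nth[of A] fps_of_nat[symmetric])
  finally show ?thesis unfolding B .
qed

text \<open>Passing \<open>P\<close> never raises the number of open positions, so the sum runs over
  \<open>h + j\<close> for all \<open>j\<close>. It is a negative binomial series in
  \<open>z = u C / (D (1 - u))\<close>, and \<open>D (1 - u) (1 - z)\<close> is the new
  denominator.\<close>

lemma open_gf_stepP:
  fixes p :: "'a::field_char_0"
  assumes open_gf: "\<And>h. open_gf G h = lam * C ^ h * inverse D ^ Suc h" and D: "fps_nth D 0 \<noteq> 0"
  defines "u \<equiv> fps_const p * fps_X"
  shows "open_gf (shape_stepP p G) h = lam * C ^ h * inverse (D * (1 - u) - C * u) ^ Suc h"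
proof (rule fps_ext)
  fix N
  define I where "I = inverse D"
  define J where "J = inverse (1 - u)"
  have DI: "D * I = 1" unfolding I_def by (rule inverse_mult_eq_1'[OF D])
  have UJ: "(1 - u) * J = 1" unfolding J_def by (rule inverse_mult_eq_1') (simp add: u_def)
  define z where "z = u * C * (I * J)"
  have z0: "fps_nth z 0 = 0" by (simp add: z_def u_def)
  let ?K = "\<lambda>j e. if h \<le> j then p ^ e * of_nat ((e choose (j - h)) * ((h + e) choose e)) else 0"
  have K: "Abs_fps (?K (h + j)) = of_nat ((h + j) choose h) * u ^ j * J ^ Suc (h + j)" for j
    unfolding u_def J_def choose_product_gf[symmetric] by simp
  have K0: "Abs_fps (?K j) = 0" if "j < h" for j
    using that by (simp add: fps_eq_iff)
  have "fps_nth (open_gf (shape_stepP p G) h) N = (\<Sum>j\<le>N + h. fps_nth (Abs_fps (?K j) * open_gf G j) N)"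
    by (rule open_gf_kernel[OF open_sum_stepP]) simp
  also have "\<dots> = (\<Sum>j\<in>{h..N + h}. fps_nth (Abs_fps (?K j) * open_gf G j) N)"
  proof (rule sum.mono_neutral_right)
    show "\<forall>j\<in>{..N + h} - {h..N + h}. fps_nth (Abs_fps (?K j) * open_gf G j) N = 0"
    proof
      fix j assume "j \<in> {..N + h} - {h..N + h}"
      then have "j < h" by auto
      then show "fps_nth (Abs_fps (?K j) * open_gf G j) N = 0" by (simp only: K0) simp
    qed
  qed auto
  also have "\<dots> = (\<Sum>j\<le>N. fps_nth (Abs_fps (?K (h + j)) * open_gf G (h + j)) N)"
    by (rule sum.reindex_bij_witness[where i = "\<lambda>j. h + j" and j = "\<lambda>j. j - h"]) auto
  also have "\<dots> = (\<Sum>j\<le>N. fps_nth (lam * C ^ h * (I * J) ^ Suc h * (of_nat ((h + j) choose h) * z ^ j)) N)"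
  proof (rule sum.cong[OF refl])
    fix j
    have "Suc (h + j) = Suc h + j" by simp
    then show "fps_nth (Abs_fps (?K (h + j)) * open_gf G (h + j)) N =
      fps_nth (lam * C ^ h * (I * J) ^ Suc h * (of_nat ((h + j) choose h) * z ^ j)) N"
      unfolding K open_gf I_def[symmetric] z_def
      by (simp only: power_mult_distrib power_add mult_ac)
  qed
  also have "\<dots> = fps_nth (lam * C ^ h * (I * J) ^ Suc h * inverse (1 - z) ^ Suc h) N"
    by (rule inverse_one_minus_power_nth[OF z0, symmetric])
  also have "lam * C ^ h * (I * J) ^ Suc h * inverse (1 - z) ^ Suc h =
      lam * C ^ h * inverse (D * (1 - u) * (1 - z)) ^ Suc h"
    unfolding I_def J_def by (simp only: fps_inverse_mult power_mult_distrib mult.assoc)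
  also have "D * (1 - u) * (1 - z) = D * (1 - u) - C * u"
  proof -
    have "D * (1 - u) * z = u * C * (D * I) * ((1 - u) * J)"
      unfolding z_def by (simp only: mult_ac)
    then show ?thesis unfolding DI UJ right_diff_distrib[of _ 1 z] by (simp add: mult.commute)
  qed
  finally show "fps_nth (open_gf (shape_stepP p G) h) N =
    fps_nth (lam * C ^ h * inverse (D * (1 - u) - C * u) ^ Suc h) N" .
qed

section \<open>Iteration over the blocks\<close>

fun shape :: "'a::comm_ring_1 \<Rightarrow> 'a \<Rightarrow> nat \<Rightarrow> nat \<Rightarrow> nat set \<Rightarrow> 'a" where
  "shape p q 0 = (\<lambda>T W. of_bool (T = 0))"
| "shape p q (Suc k) = shape_stepE q (shape_stepP p (shape p q k))"

lemma represents_weighted_count: "represents (weighted_count p q k) (shape p q k)"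
proof (induction k)
  case 0
  show ?case using represents_weighted_count_0 by simp
next
  case (Suc k)
  have "represents (stepE q (stepP p (weighted_count p q k))) (shape p q (Suc k))"
    unfolding shape.simps by (intro represents_stepE represents_stepP Suc)
  then show ?case by (simp add: represents_def weighted_count_Suc)
qed

text \<open>Each round maps \<open>C\<close> and \<open>D\<close> to \<open>C + D1 * y\<close> and
  \<open>D1 * (1 - y)\<close> with \<open>D1 = D * (1 - u) - C * u\<close>. This linear recursion
  starts from \<open>C = 0\<close>, \<open>D = 1\<close> and is solved by combinations of
  \<open>a ^ k\<close> and \<open>b ^ k\<close>; the factor \<open>fps_const (p - q)\<close> clears
  the denominator of the solution.\<close>

lemma open_gf_shape:
  fixes p q :: "'a::field_char_0" and k :: nat
  defines "a \<equiv> 1 - fps_const p * fps_X" and "b \<equiv> 1 - fps_const q * fps_X"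
  shows "\<exists>C D. fps_const (p - q) * C = fps_const q * a * (b ^ k - a ^ k) \<and>
    fps_const (p - q) * D = fps_const p * b * a ^ k - fps_const q * a * b ^ k \<and> fps_nth D 0 \<noteq> 0 \<and>
    (\<forall>h. open_gf (shape p q k) h = b ^ k * C ^ h * inverse D ^ Suc h)"
proof (induction k)
  case 0
  have 1: "{W. W \<subseteq> {1..T} \<and> card W + h = T} = (if h = 0 then {{}} else {})" if "T = 0" for T h :: nat
    using that by auto
  have "open_sum (shape p q 0) T h = (if T = 0 \<and> h = 0 then 1 else 0)" for T h
    unfolding open_sum_def by (cases "T = 0") (simp_all only: 1, auto)
  \<comment> \<open>Here \<open>C = 0\<close> and \<open>D = 1\<close>; since
    \<open>0 ^ 0 = 1\<close>, only \<open>h = 0\<close> survives.\<close>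
  then have "open_gf (shape p q 0) h = b ^ 0 * 0 ^ h * inverse 1 ^ Suc h" for h
    by (cases h) (simp_all add: open_gf_def fps_eq_iff)
  moreover have "fps_const (p - q) * 1 = fps_const p * b * a ^ 0 - fps_const q * a * b ^ 0"
    by (simp add: a_def b_def algebra_simps flip: fps_const_sub)
  ultimately show ?case by (intro exI[of _ 0] exI[of _ 1]) simp
next
  case (Suc k)
  then obtain C D where C: "fps_const (p - q) * C = fps_const q * a * (b ^ k - a ^ k)"
    and D: "fps_const (p - q) * D = fps_const p * b * a ^ k - fps_const q * a * b ^ k"
    and D0: "fps_nth D 0 \<noteq> 0"
    and open_gf: "\<And>h. open_gf (shape p q k) h = b ^ k * C ^ h * inverse D ^ Suc h" by blast
  define u where "u = fps_const p * fps_X"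
  define y where "y = fps_const q * fps_X"
  define D1 where "D1 = D * (1 - u) - C * u"
  have D10: "fps_nth D1 0 \<noteq> 0" using D0 by (simp add: D1_def u_def)
  have psi1: "open_gf (shape_stepP p (shape p q k)) h = b ^ k * C ^ h * inverse D1 ^ Suc h" for h
    unfolding D1_def u_def by (rule open_gf_stepP[OF open_gf D0])
  have psi2: "open_gf (shape p q (Suc k)) h = b ^ Suc k * (C + D1 * y) ^ h * inverse (D1 * (1 - y)) ^ Suc h" for h
    using open_gf_stepE[OF psi1 D10] by (simp add: y_def b_def mult_ac)
  have ab: "a = 1 - u" "b = 1 - y" by (simp_all add: a_def b_def u_def y_def)
  have pq: "fps_const p * y = fps_const q * u" by (simp add: u_def y_def mult_ac)
  have "fps_const (p - q) * D1 = (fps_const (p - q) * D) * a - (fps_const (p - q) * C) * u"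
    unfolding D1_def ab by (simp add: algebra_simps)
  also have "\<dots> = a ^ Suc k * (fps_const p * b + fps_const q * u) - fps_const q * a * b ^ k * (a + u)"
    unfolding C D by (simp add: algebra_simps)
  also have "fps_const p * b + fps_const q * u = fps_const p"
    unfolding ab pq[symmetric] by (simp add: algebra_simps)
  also have "a + u = 1" by (simp add: ab)
  finally have D1: "fps_const (p - q) * D1 = fps_const p * a ^ Suc k - fps_const q * a * b ^ k"
    by (simp add: mult_ac)
  have "fps_const (p - q) * (D1 * (1 - y)) = (fps_const (p - q) * D1) * b" by (simp add: ab mult_ac)
  also have "\<dots> = fps_const p * b * a ^ Suc k - fps_const q * a * b ^ Suc k"
    unfolding D1 by (simp add: algebra_simps)
  finally have D2: "fps_const (p - q) * (D1 * (1 - y)) = fps_const p * b * a ^ Suc k - fps_const q * a * b ^ Suc k" .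
  have "fps_const (p - q) * (C + D1 * y) = fps_const (p - q) * C + (fps_const (p - q) * D1) * y"
    by (simp add: algebra_simps)
  also have "\<dots> = fps_const q * a * (b ^ k * (1 - y)) + a ^ Suc k * (fps_const p * y) - fps_const q * a ^ Suc k"
    unfolding C D1 by (simp add: algebra_simps)
  also have "\<dots> = fps_const q * a * (b ^ Suc k - a ^ Suc k)"
    unfolding pq ab(2)[symmetric] by (simp add: algebra_simps ab(1))
  finally have C2: "fps_const (p - q) * (C + D1 * y) = fps_const q * a * (b ^ Suc k - a ^ Suc k)" .
  have "fps_nth (D1 * (1 - y)) 0 \<noteq> 0" using D10 by (simp add: y_def)
  with C2 D2 psi2 show ?case by blast
qed

text \<open>For \<open>h = 0\<close> no value lies above \<open>n\<close>, so \<open>{1..n}\<close>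
  is the only contributing set and \<open>open_gf\<close> is the ordinary generating
  function.\<close>

lemma weighted_count_gf:
  fixes p q :: "'a::field_char_0" and k :: nat
  defines "a \<equiv> 1 - fps_const p * fps_X" and "b \<equiv> 1 - fps_const q * fps_X"
  shows "Abs_fps (\<lambda>n. weighted_count p q k {1..n}) * (fps_const p * b * a ^ k - fps_const q * a * b ^ k) =
    fps_const (p - q) * b ^ k"
proof -
  have "{W. W \<subseteq> {1..n} \<and> card W + 0 = n} = {{1..n}}" for n :: nat
    using card_subset_eq[of "{1..n}"] by auto
  then have "open_sum (shape p q k) n 0 = shape p q k n {1..n}" for n
    unfolding open_sum_def by simp
  moreover have "weighted_count p q k {1..n} = shape p q k n {1..n}" for n
    using represents_weighted_count[of p q k] by (simp add: represents_def)
  ultimately have open_gf: "Abs_fps (\<lambda>n. weighted_count p q k {1..n}) = open_gf (shape p q k) 0"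
    by (simp add: open_gf_def)
  obtain C D where D: "fps_const (p - q) * D = fps_const p * b * a ^ k - fps_const q * a * b ^ k"
    "fps_nth D 0 \<noteq> 0" and "open_gf (shape p q k) 0 = b ^ k * C ^ 0 * inverse D ^ Suc 0"
    using open_gf_shape[of p q k] unfolding a_def b_def by blast
  then have "open_gf (shape p q k) 0 * (fps_const (p - q) * D) = fps_const (p - q) * b ^ k * (inverse D * D)"
    by (simp add: mult_ac)
  then show ?thesis using D unfolding open_gf by (simp add: inverse_mult_eq_1)
qed

section \<open>Permutations as words\<close>

definition rword :: "nat \<Rightarrow> (nat \<Rightarrow> nat) \<Rightarrow> nat list" where
  "rword n \<pi> = map \<pi> (rev [1..<Suc n])"

lemma rword_simps [simp]:
  "rword 0 \<pi> = []" "rword (Suc n) \<pi> = \<pi> (Suc n) # rword n \<pi>" "length (rword n \<pi>) = n"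
  by (simp_all add: rword_def)

lemma rdes_rword: "rdes (rword n \<pi>) = des n \<pi>"
proof (induction n)
  case 0
  show ?case by (simp add: des_def)
next
  case (Suc m)
  show ?case
  proof (cases m)
    case 0
    then show ?thesis by (simp add: des_def)
  next
    case (Suc k)
    have "{i \<in> {1..<Suc m}. \<pi> i > \<pi> (i + 1)} = {i \<in> {1..<m}. \<pi> i > \<pi> (i + 1)} \<union> {i. i = m \<and> \<pi> i > \<pi> (i + 1)}"
      using Suc by auto
    moreover have "card ({i \<in> {1..<m}. \<pi> i > \<pi> (i + 1)} \<union> {i. i = m \<and> \<pi> i > \<pi> (i + 1)}) =
      card {i \<in> {1..<m}. \<pi> i > \<pi> (i + 1)} + card {i. i = m \<and> \<pi> i > \<pi> (i + 1)}"
      by (rule card_Un_disjoint) auto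
    moreover have "card {i. i = m \<and> \<pi> i > \<pi> (i + 1)} = of_bool (\<pi> m > \<pi> (m + 1))"
      by (cases "\<pi> m > \<pi> (m + 1)") (simp_all cong: conj_cong)
    ultimately have "des (Suc m) \<pi> = of_bool (\<pi> m > \<pi> (m + 1)) + des m \<pi>"
      by (simp only: des_def add.commute)
    with Suc.IH Suc show ?thesis by simp
  qed
qed

lemma exc_Suc: "exc (Suc n) \<pi> = of_bool (\<pi> (Suc n) > Suc n) + exc n \<pi>"
proof -
  have "{i \<in> {1..Suc n}. \<pi> i > i} = {i \<in> {1..n}. \<pi> i > i} \<union> {i. i = Suc n \<and> \<pi> i > i}"
    by (auto simp: le_Suc_eq)
  moreover have "card ({i \<in> {1..n}. \<pi> i > i} \<union> {i. i = Suc n \<and> \<pi> i > i}) =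
      card {i \<in> {1..n}. \<pi> i > i} + card {i. i = Suc n \<and> \<pi> i > i}"
    by (rule card_Un_disjoint) auto
  moreover have "card {i. i = Suc n \<and> \<pi> i > i} = of_bool (\<pi> (Suc n) > Suc n)"
    by (cases "\<pi> (Suc n) > Suc n") (simp_all cong: conj_cong)
  ultimately show ?thesis by (simp only: exc_def add.commute)
qed

lemma exc_le: "exc n \<pi> \<le> n"
  by (induction n) (auto simp: exc_Suc, simp add: exc_def)

lemma exc_weight_rword: "exc_weight p q (rword n \<pi>) = p ^ (n - exc n \<pi>) * q ^ exc n \<pi>"
proof (induction n)
  case 0
  show ?case by (simp add: exc_def)
next
  case (Suc n)
  then show ?case using exc_le[of n \<pi>] by (auto simp: exc_Suc Suc_diff_le mult_ac)
qed

lemma bij_betw_rword: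
  "bij_betw (rword n) {\<pi>. \<pi> permutes {1..n}} (permutations_of_set {1..n})"
proof -
  have inj: "inj_on (rword n) {\<pi>. \<pi> permutes {1..n}}"
  proof (rule inj_onI)
    fix \<pi> \<sigma> assume p: "\<pi> \<in> {\<pi>. \<pi> permutes {1..n}}" "\<sigma> \<in> {\<pi>. \<pi> permutes {1..n}}"
      and eq: "rword n \<pi> = rword n \<sigma>"
    have "\<pi> i = \<sigma> i" for i
    proof (cases "i \<in> {1..n}")
      case True
      then have "i \<in> set (rev [1..<Suc n])" by auto
      with eq show ?thesis unfolding rword_def map_eq_conv by blast
    next
      case False
      then show ?thesis using p by (auto simp: permutes_def)
    qed
    then show "\<pi> = \<sigma>" by blast
  qed
  have sub: "rword n ` {\<pi>. \<pi> permutes {1..n}} \<subseteq> permutations_of_set {1..n}"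
  proof
    fix xs assume "xs \<in> rword n ` {\<pi>. \<pi> permutes {1..n}}"
    then obtain \<pi> where xs: "xs = rword n \<pi>" and p: "\<pi> permutes {1..n}" by blast
    have S: "set (rev [1..<Suc n]) = {1..n}" by auto
    have "set xs = {1..n}" unfolding xs rword_def set_map S by (rule permutes_image[OF p])
    moreover have "distinct xs" unfolding xs rword_def distinct_map S
      using permutes_inj_on[OF p] by simp
    ultimately show "xs \<in> permutations_of_set {1..n}" by blast
  qed
  \<comment> \<open>Surjectivity by counting: both sides have \<open>n!\<close> elements.\<close>
  have "card (rword n ` {\<pi>. \<pi> permutes {1..n}}) = card (permutations_of_set {1..n})"
    unfolding card_image[OF inj] by (subst card_permutations[of _ n]) simp_all
  with sub have "rword n ` {\<pi>. \<pi> permutes {1..n}} = permutations_of_set {1..n}"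
    by (intro card_subset_eq) auto
  with inj show ?thesis by (simp add: bij_betw_def)
qed

text \<open>Summing \<open>num_factorizations_gf\<close> over all words turns the descent factor
  into a series in \<open>r\<close>. With \<open>p = 1\<close>, \<open>q = t\<close> the left-hand
  side is \<open>A_n(s, t)\<close>; with \<open>p = t\<close>, \<open>q = 1\<close> it is
  \<open>t^n A_n(s, 1/t)\<close>.\<close>

lemma des_exc_gf:
  fixes p q :: "'a::comm_ring_1"
  shows "(\<Sum>\<pi> | \<pi> permutes {1..n}. fps_X ^ des n \<pi> * fps_const (p ^ (n - exc n \<pi>) * q ^ exc n \<pi>)) =
    (1 - fps_X) ^ Suc n * Abs_fps (\<lambda>r. weighted_count p q (Suc r) {1..n})"
proof -
  have "(\<Sum>\<pi> | \<pi> permutes {1..n}. fps_X ^ des n \<pi> * fps_const (p ^ (n - exc n \<pi>) * q ^ exc n \<pi>)) =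
    (\<Sum>\<pi> | \<pi> permutes {1..n}. fps_X ^ rdes (rword n \<pi>) * fps_const (exc_weight p q (rword n \<pi>)))"
    by (simp only: rdes_rword exc_weight_rword)
  also have "\<dots> = (\<Sum>xs\<in>permutations_of_set {1..n}. fps_X ^ rdes xs * fps_const (exc_weight p q xs))"
    by (rule sum.reindex_bij_betw[OF bij_betw_rword])
  also have "\<dots> = (\<Sum>xs\<in>permutations_of_set {1..n}. (1 - fps_X) ^ Suc n *
      (Abs_fps (\<lambda>r. of_nat (num_factorizations (Suc r) xs)) * fps_const (exc_weight p q xs)))"
  proof (rule sum.cong[OF refl])
    fix xs assume xs: "xs \<in> permutations_of_set {1..n}"
    then have "distinct xs" by (auto simp: permutations_of_set_def)
    moreover have "length xs = n" using xs by (simp add: length_finite_permutations_of_set)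
    ultimately show "fps_X ^ rdes xs * fps_const (exc_weight p q xs) =
      (1 - fps_X) ^ Suc n * (Abs_fps (\<lambda>r. of_nat (num_factorizations (Suc r) xs)) * fps_const (exc_weight p q xs))"
      using num_factorizations_gf[of xs, where 'a = 'a] by (simp only: mult_ac)
  qed
  also have "\<dots> = (1 - fps_X) ^ Suc n * (\<Sum>xs\<in>permutations_of_set {1..n}.
      Abs_fps (\<lambda>r. of_nat (num_factorizations (Suc r) xs)) * fps_const (exc_weight p q xs))"
    by (simp only: sum_distrib_left)
  also have "(\<Sum>xs\<in>permutations_of_set {1..n}. Abs_fps (\<lambda>r. of_nat (num_factorizations (Suc r) xs)) * fps_const (exc_weight p q xs)) =
      Abs_fps (\<lambda>r. weighted_count p q (Suc r) {1..n})"
    by (rule fps_ext) (simp add: fps_sum_nth weighted_count_def del: num_factorizations.simps)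
  finally show ?thesis .
qed

section \<open>Specialization to \<open>a_n\<close>\<close>

lemma tvar_neq: "tvar \<noteq> 0" "tvar \<noteq> 1"
proof -
  have "to_fract [:0, 1 :: rat:] \<noteq> to_fract 0" "to_fract [:0, 1 :: rat:] \<noteq> to_fract 1"
    unfolding to_fract_eq_iff by (simp_all add: one_pCons)
  then show "tvar \<noteq> 0" "tvar \<noteq> 1" by (simp_all add: tvar_def)
qed

lemma a_poly_eq:
  "a_poly n = (1 - fps_X) ^ Suc n *
    Abs_fps (\<lambda>r. (weighted_count 1 tvar (Suc r) {1..n} - weighted_count tvar 1 (Suc r) {1..n}) / (1 - tvar))"
proof -
  let ?P = "{\<pi>. \<pi> permutes {1..n}}"
  let ?w = "\<lambda>p q. Abs_fps (\<lambda>r. weighted_count p q (Suc r) {1..n}) :: Qt fps"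
  have 1: "A_poly n fps_X (fps_const tvar) = (1 - fps_X) ^ Suc n * ?w 1 tvar"
    unfolding des_exc_gf[symmetric] A_poly_def by simp
  have "fps_const tvar ^ n * A_poly n fps_X (fps_const (1 / tvar)) =
    (\<Sum>\<pi>\<in>?P. fps_X ^ des n \<pi> * fps_const (tvar ^ (n - exc n \<pi>) * 1 ^ exc n \<pi>))"
    unfolding A_poly_def sum_distrib_left
  proof (rule sum.cong[OF refl])
    fix \<pi>
    have "tvar ^ n * (1 / tvar) ^ exc n \<pi> = tvar ^ (n - exc n \<pi>) * 1 ^ exc n \<pi>"
      using tvar_neq(1) exc_le[of n \<pi>] by (simp add: power_diff power_one_over)
    then have "fps_const tvar ^ n * fps_const (1 / tvar) ^ exc n \<pi> =
        fps_const (tvar ^ (n - exc n \<pi>) * 1 ^ exc n \<pi>)"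
      by (simp only: fps_const_power fps_const_mult)
    then show "fps_const tvar ^ n * (fps_X ^ des n \<pi> * fps_const (1 / tvar) ^ exc n \<pi>) =
      fps_X ^ des n \<pi> * fps_const (tvar ^ (n - exc n \<pi>) * 1 ^ exc n \<pi>)"
      by (subst mult.left_commute) (rule arg_cong)
  qed
  also have "\<dots> = (1 - fps_X) ^ Suc n * ?w tvar 1" by (rule des_exc_gf)
  finally have 2: "fps_const tvar ^ n * A_poly n fps_X (fps_const (1 / tvar)) = (1 - fps_X) ^ Suc n * ?w tvar 1" .
  have c: "1 - fps_const tvar = fps_const (1 - tvar)" by (simp flip: fps_const_sub)
  have "(A_poly n fps_X (fps_const tvar) - fps_const tvar ^ n * A_poly n fps_X (fps_const (1 / tvar)))
    / (1 - fps_const tvar) = (1 - fps_X) ^ Suc n * ((?w 1 tvar - ?w tvar 1) * fps_const (inverse (1 - tvar)))"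
    unfolding 1 2 c using tvar_neq
    by (subst fps_divide_unit) (simp_all add: fps_const_inverse right_diff_distrib left_diff_distrib mult.assoc)
  also have "(?w 1 tvar - ?w tvar 1) * fps_const (inverse (1 - tvar)) =
    Abs_fps (\<lambda>r. (weighted_count 1 tvar (Suc r) {1..n} - weighted_count tvar 1 (Suc r) {1..n}) / (1 - tvar))"
    by (rule fps_ext) (simp add: divide_inverse)
  finally have "(A_poly n fps_X (fps_const tvar) - fps_const tvar ^ n * A_poly n fps_X (fps_const (1 / tvar)))
    / (1 - fps_const tvar) = (1 - fps_X) ^ Suc n *
    Abs_fps (\<lambda>r. (weighted_count 1 tvar (Suc r) {1..n} - weighted_count tvar 1 (Suc r) {1..n}) / (1 - tvar))" .
  \<comment> \<open>For \<open>n = 0\<close> both polynomials are 1, so the quotient agrees with the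
    convention \<open>a_0 = 0\<close>.\<close>
  moreover have "a_poly n = (A_poly n fps_X (fps_const tvar) - fps_const tvar ^ n * A_poly n fps_X (fps_const (1 / tvar)))
    / (1 - fps_const tvar)"
    by (simp add: a_poly_def A_poly_def des_def exc_def)
  ultimately show ?thesis by simp
qed

section \<open>The determinant\<close>

definition alpha_gf :: "nat \<Rightarrow> Qt fps" where
  "alpha_gf r = Abs_fps (\<lambda>k. alpha r (int k))"

lemma alpha_gf_0: "fps_nth (alpha_gf r) 0 = 1"
  using tvar_neq by (simp add: alpha_gf_def alpha_def tbracket_def)

text \<open>As in Cramer's rule: the coefficients of the quotient series \<open>x\<close> solve the
  triangular Toeplitz system with right-hand side \<open>beta\<close>. Putting them into the last
  column of the identity matrix gives \<open>U\<close> with \<open>M = L U\<close>; both factors are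
  triangular, and \<open>det L = 1\<close> because \<open>alpha r 0 = 1\<close>.\<close>

lemma det_M_mat: "det (M_mat n r) = fps_nth (Abs_fps (beta r) * inverse (alpha_gf r)) n"
proof -
  define x where "x = Abs_fps (beta r) * inverse (alpha_gf r)"
  have xa: "alpha_gf r * x = Abs_fps (beta r)"
    using inverse_mult_eq_1[of "alpha_gf r"] by (simp add: x_def alpha_gf_0 mult_ac)
  define L where "L = mat (n + 1) (n + 1) (\<lambda>(i, j). alpha r (int i - int j))"
  define U where "U = mat (n + 1) (n + 1) (\<lambda>(i, j). if j < n then of_bool (i = j) else fps_nth x i)"
  have carr: "L \<in> carrier_mat (n + 1) (n + 1)" "U \<in> carrier_mat (n + 1) (n + 1)"
    by (simp_all add: L_def U_def)
  have "M_mat n r = L * U"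
  proof (rule eq_matI)
    fix i j assume "i < dim_row (L * U)" "j < dim_col (L * U)"
    then have ij: "i < n + 1" "j < n + 1" using carr by auto
    have LU: "(L * U) $$ (i, j) = (\<Sum>l = 0..<n + 1. alpha r (int i - int l) * U $$ (l, j))"
      using ij by (simp add: L_def U_def scalar_prod_def)
    show "M_mat n r $$ (i, j) = (L * U) $$ (i, j)"
    proof (cases "j < n")
      case True
      have "(L * U) $$ (i, j) = (\<Sum>l = 0..<n + 1. if l = j then alpha r (int i - int l) else 0)"
        unfolding LU using True ij by (intro sum.cong refl) (auto simp: U_def)
      then show ?thesis using True ij by (simp add: M_mat_def)
    next
      case False
      then have j: "j = n" using ij by simp
      have "(L * U) $$ (i, j) = (\<Sum>l = 0..<n + 1. alpha r (int i - int l) * fps_nth x l)"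
        unfolding LU using j by (intro sum.cong refl) (auto simp: U_def)
      \<comment> \<open>Terms with \<open>l > i\<close> vanish because \<open>alpha\<close> is 0 at
        negative arguments; a Cauchy product is left.\<close>
      also have "\<dots> = (\<Sum>l = 0..i. alpha r (int i - int l) * fps_nth x l)"
        using ij by (intro sum.mono_neutral_right) (auto simp: alpha_def)
      also have "\<dots> = (\<Sum>l = 0..i. fps_nth x l * fps_nth (alpha_gf r) (i - l))"
        by (intro sum.cong refl) (simp add: alpha_gf_def of_nat_diff mult.commute)
      also have "\<dots> = fps_nth (alpha_gf r * x) i"
        by (simp only: mult.commute[of "alpha_gf r"] fps_mult_nth)
      also have "\<dots> = beta r i" by (simp add: xa)
      finally show ?thesis using ij j by (simp add: M_mat_def)
    qed
  qed (simp_all add: M_mat_def L_def U_def)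
  moreover have "det L = 1"
  proof -
    have "det L = prod_list (diag_mat L)"
      by (rule det_lower_triangular[OF _ carr(1)]) (simp add: L_def alpha_def)
    also have "diag_mat L = map (\<lambda>i. 1) [0..<n + 1]"
      unfolding diag_mat_def using tvar_neq
      by (intro map_cong) (auto simp: L_def alpha_def tbracket_def)
    finally show ?thesis by (simp add: map_replicate_const)
  qed
  moreover have "det U = fps_nth x n"
  proof -
    have "det U = prod_list (diag_mat U)"
      by (rule det_upper_triangular[OF _ carr(2)]) (auto simp: U_def)
    also have "diag_mat U = map (\<lambda>i. if i < n then 1 else fps_nth x i) [0..<n + 1]"
      unfolding diag_mat_def by (intro map_cong) (auto simp: U_def)
    also have "prod_list \<dots> = fps_nth x n"
    proof -
      have "map (\<lambda>i. if i < n then 1 else fps_nth x i) [0..<n] = map (\<lambda>i. 1) [0..<n]"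
        by (rule map_cong) auto
      then show ?thesis by (simp add: map_replicate_const)
    qed
    finally show ?thesis .
  qed
  ultimately show ?thesis using carr by (simp add: det_mult x_def)
qed

section \<open>Binomial series for \<open>alpha\<close> and \<open>beta\<close>\<close>

text \<open>The series \<open>(1 - c X)^x\<close> with exponent \<open>x\<close> in the field, so
  that \<open>x = r - 1\<close> also covers \<open>r = 0\<close>, where the exponent is
  \<open>-1\<close>.\<close>

definition binomial_gf :: "'a::field_char_0 \<Rightarrow> 'a \<Rightarrow> 'a fps" where
  "binomial_gf c x = fps_binomial x oo (fps_const (- c) * fps_X)"

lemma binomial_gf_nth: "fps_nth (binomial_gf c x) k = (-1) ^ k * (x gchoose k) * c ^ k"
  unfolding binomial_gf_def fps_compose_linear by (simp add: power_minus[of c] mult_ac)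

lemma binomial_gf_of_nat: "binomial_gf c (of_nat r) = (1 - fps_const c * fps_X) ^ r"
  unfolding binomial_gf_def fps_binomial_of_nat
  by (simp add: fps_compose_power[symmetric] fps_compose_add_distrib flip: fps_const_neg)

lemma binomial_gf_minus_one:
  "binomial_gf c (of_nat r - 1) * (1 - fps_const c * fps_X) = (1 - fps_const c * fps_X) ^ r"
proof -
  have "binomial_gf c (of_nat r - 1) * binomial_gf c (of_nat 1) = binomial_gf c (of_nat r)"
    unfolding binomial_gf_def
    by (subst fps_compose_mult_distrib[symmetric]) (simp_all flip: fps_binomial_add_mult)
  then show ?thesis unfolding binomial_gf_of_nat by simp
qed

text \<open>Since \<open>(1 - t) * tbracket (k + 1) = 1 - t * t^k\<close>, each coefficient
  separates into terms of two binomial series.\<close>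

lemma alpha_gf_eq:
  "fps_const (1 - tvar) * alpha_gf r =
    (1 - fps_X) ^ r - fps_const tvar * (1 - fps_const tvar * fps_X) ^ r"
proof -
  have "fps_const (1 - tvar) * alpha_gf r =
    binomial_gf 1 (of_nat r) - fps_const tvar * binomial_gf tvar (of_nat r)"
  proof (rule fps_ext)
    fix k
    have "(1 - tvar) * tbracket (k + 1) = 1 - tvar * tvar ^ k"
      using tvar_neq by (simp add: tbracket_def)
    then have "(1 - tvar) * ((- 1) ^ k * (of_nat r gchoose k) * tbracket (k + 1)) =
       (- 1) ^ k * (of_nat r gchoose k) * (1 - tvar * tvar ^ k)"
      by (metis mult.left_commute)
    then show "fps_nth (fps_const (1 - tvar) * alpha_gf r) k =
      fps_nth (binomial_gf 1 (of_nat r) - fps_const tvar * binomial_gf tvar (of_nat r)) k"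
      by (simp add: alpha_gf_def alpha_def binomial_gf_nth right_diff_distrib mult_ac)
  qed
  then show ?thesis by (simp add: binomial_gf_of_nat)
qed

lemma beta_gf_eq:
  "fps_const (1 - tvar) * Abs_fps (beta r) =
    binomial_gf 1 (of_nat r - 1) - fps_const (tvar ^ 2) * binomial_gf tvar (of_nat r - 1)"
proof (rule fps_ext)
  fix k
  have "(1 - tvar) * tbracket (k + 2) = 1 - tvar ^ 2 * tvar ^ k"
    using tvar_neq by (simp add: tbracket_def power2_eq_square)
  then have "(1 - tvar) * ((- 1) ^ k * (of_nat r - 1 gchoose k) * tbracket (k + 2)) =
     (- 1) ^ k * (of_nat r - 1 gchoose k) * (1 - tvar ^ 2 * tvar ^ k)"
    by (metis mult.left_commute)
  then show "fps_nth (fps_const (1 - tvar) * Abs_fps (beta r)) k =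
    fps_nth (binomial_gf 1 (of_nat r - 1) - fps_const (tvar ^ 2) * binomial_gf tvar (of_nat r - 1)) k"
    by (simp add: beta_def binomial_gf_nth right_diff_distrib mult_ac)
qed

section \<open>Comparison of the two generating functions\<close>

text \<open>Taken as series in \<open>X\<close> over all \<open>n\<close>, the two counts
  \<open>W1\<close> and \<open>W2\<close>, the determinants \<open>S\<close> and the correction
  \<open>Geo\<close> all become elementary after multiplication by \<open>a * b * Dd\<close>. The
  claim then reduces to \<open>b a^r - t^2 a b^r - (b + t a) (a^r - t b^r) = t (b^(r+1) -
  a^(r+1))\<close>.\<close>

lemma weighted_count_det:
  "(weighted_count 1 tvar (Suc r) {1..n} - weighted_count tvar 1 (Suc r) {1..n}) / (1 - tvar) =
    (det (M_mat n r) - (1 + tvar ^ (n + 1))) / tvar"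
proof -
  define t where "t = fps_const tvar"
  define a where "a = (1 - fps_X :: Qt fps)"
  define b where "b = (1 - t * fps_X :: Qt fps)"
  define Dd where "Dd = a ^ r - t * b ^ r"
  define S where "S = Abs_fps (beta r) * inverse (alpha_gf r)"
  define Geo where "Geo = Abs_fps (\<lambda>n. 1 + tvar ^ (n + 1))"
  define W1 where "W1 = Abs_fps (\<lambda>n. weighted_count 1 tvar (Suc r) {1..n})"
  define W2 where "W2 = Abs_fps (\<lambda>n. weighted_count tvar 1 (Suc r) {1..n})"
  have c1: "fps_const (1 - tvar) = 1 - t" by (simp add: t_def flip: fps_const_sub)
  have c2: "fps_const (tvar - 1) = t - 1" by (simp add: t_def flip: fps_const_sub)
  have "W1 * (b * a ^ Suc r - t * a * b ^ Suc r) = (1 - t) * b ^ Suc r"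
    using weighted_count_gf[of 1 tvar "Suc r"] by (simp only: W1_def c1 a_def b_def t_def fps_const_1_eq_1 mult_1)
  then have W1: "W1 * (a * b * Dd) = (1 - t) * b ^ Suc r"
    by (simp add: Dd_def algebra_simps)
  \<comment> \<open>Exchanging the weights swaps \<open>a\<close> and \<open>b\<close>; up to sign
    the denominator stays the same.\<close>
  have "W2 * (t * a * b ^ Suc r - b * a ^ Suc r) = (t - 1) * a ^ Suc r"
    using weighted_count_gf[of tvar 1 "Suc r"] by (simp only: W2_def c2 a_def b_def t_def fps_const_1_eq_1 mult_1)
  then have W2: "W2 * (a * b * Dd) = (1 - t) * a ^ Suc r"
    by (simp add: Dd_def algebra_simps)
  have "S * alpha_gf r = Abs_fps (beta r)"
    using inverse_mult_eq_1[of "alpha_gf r"] by (simp add: S_def alpha_gf_0 mult.assoc)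
  moreover have "S * ((1 - t) * alpha_gf r) * (a * b) = ((1 - t) * (S * alpha_gf r)) * (a * b)"
    by (simp only: mult_ac)
  moreover have "(1 - t) * alpha_gf r = Dd"
    using alpha_gf_eq[of r] by (simp add: c1 Dd_def a_def b_def t_def)
  moreover have "((1 - t) * Abs_fps (beta r)) * (a * b) = b * a ^ r - t ^ 2 * a * b ^ r"
  proof -
    have "(1 - t) * Abs_fps (beta r) = binomial_gf 1 (of_nat r - 1) - t ^ 2 * binomial_gf tvar (of_nat r - 1)"
      using beta_gf_eq[of r] by (simp add: c1 t_def)
    moreover have "binomial_gf 1 (of_nat r - 1) * a = a ^ r"
      using binomial_gf_minus_one[of 1 r] by (simp add: a_def)
    moreover have "binomial_gf tvar (of_nat r - 1) * b = b ^ r"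
      using binomial_gf_minus_one[of tvar r] by (simp add: b_def t_def)
    moreover have "(x - t ^ 2 * y) * (a * b) = b * (x * a) - t ^ 2 * a * (y * b)" for x y
      by (simp add: algebra_simps)
    ultimately show ?thesis by simp
  qed
  ultimately have "S * Dd * (a * b) = b * a ^ r - t ^ 2 * a * b ^ r" by (simp only:)
  then have S: "S * (a * b * Dd) = b * a ^ r - t ^ 2 * a * b ^ r" by (simp only: mult_ac)
  have Geo: "Geo * (a * b) = b + t * a"
  proof -
    have 1: "Abs_fps (\<lambda>n. 1) * a = (1 :: Qt fps)"
      unfolding a_def by (rule fps_ext) (auto simp: right_diff_distrib)
    have 2: "Abs_fps (\<lambda>n. tvar ^ n) * b = 1"
    proof (rule fps_ext)
      fix k show "fps_nth (Abs_fps (\<lambda>n. tvar ^ n) * b) k = fps_nth 1 k"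
        unfolding b_def t_def by (cases k) (simp_all add: right_diff_distrib mult.left_commute[of _ "fps_const tvar"])
    qed
    have "Geo = Abs_fps (\<lambda>n. 1) + t * Abs_fps (\<lambda>n. tvar ^ n)"
      by (rule fps_ext) (simp add: Geo_def t_def)
    then have "Geo * (a * b) = (Abs_fps (\<lambda>n. 1) * a) * b + t * a * (Abs_fps (\<lambda>n. tvar ^ n) * b)"
      by (simp add: algebra_simps)
    then show ?thesis unfolding 1 2 by simp
  qed
  have "t * (W1 - W2) * (a * b * Dd) = t * (W1 * (a * b * Dd)) - t * (W2 * (a * b * Dd))"
    by (simp add: algebra_simps)
  also have "\<dots> = (1 - t) * (b * a ^ r - t ^ 2 * a * b ^ r - (b + t * a) * Dd)"
    unfolding W1 W2 by (simp add: Dd_def algebra_simps power2_eq_square)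
  also have "\<dots> = (1 - t) * (S - Geo) * (a * b * Dd)"
    unfolding S[symmetric] Geo[symmetric] by (simp add: algebra_simps)
  finally have "t * (W1 - W2) * (a * b * Dd) = (1 - t) * (S - Geo) * (a * b * Dd)" .
  \<comment> \<open>The constant term \<open>1 - t\<close> is nonzero, so the factor can be
    cancelled in the domain of power series.\<close>
  moreover have "a * b * Dd \<noteq> 0"
  proof
    assume zero: "a * b * Dd = 0"
    have "fps_nth (a * b * Dd) 0 = 1 - tvar"
      by (simp add: a_def b_def Dd_def t_def fps_power_zeroth)
    then show False using tvar_neq unfolding zero by simp
  qed
  ultimately have "t * (W1 - W2) = (1 - t) * (S - Geo)" by simp
  then have "fps_nth (fps_const tvar * (W1 - W2)) n = fps_nth (fps_const (1 - tvar) * (S - Geo)) n"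
    by (simp only: c1 t_def)
  then have "tvar * (weighted_count 1 tvar (Suc r) {1..n} - weighted_count tvar 1 (Suc r) {1..n}) =
      (1 - tvar) * (det (M_mat n r) - (1 + tvar ^ (n + 1)))"
    by (simp add: W1_def W2_def Geo_def det_M_mat S_def[symmetric])
  moreover have "x / (1 - tvar) = y / tvar" if "tvar * x = (1 - tvar) * y" for x y
    using that tvar_neq by (simp add: field_simps)
  ultimately show ?thesis by blast
qed

theorem theorem6:
  fixes n :: nat
  shows "a_poly n =
    - ((1 + fps_const tvar ^ (n + 1)) * (1 - fps_X) ^ n / fps_const tvar)
    + (1 - fps_X) ^ (n + 1) / fps_const tvar * Abs_fps (\<lambda>r. det (M_mat n r))"
proof -
  let ?i = "fps_const (inverse tvar)"
  have div: "f / fps_const tvar = f * ?i" for f :: "Qt fps"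
    using tvar_neq by (simp add: fps_divide_unit fps_const_inverse)
  \<comment> \<open>The geometric series supplies the missing factor \<open>1 - s\<close> and moves
    the correction \<open>1 + t^(n+1)\<close> inside the sum over \<open>r\<close>.\<close>
  have ones: "(1 - fps_X) ^ n = (1 - fps_X) ^ (n + 1) * Abs_fps (\<lambda>_. 1 :: Qt)"
  proof -
    have "(1 - fps_X) * Abs_fps (\<lambda>_. 1) = (1 :: Qt fps)"
      by (rule fps_ext) (auto simp: left_diff_distrib)
    then show ?thesis by (simp add: mult_ac)
  qed
  have rhs: "Abs_fps (\<lambda>r. (det (M_mat n r) - (1 + tvar ^ (n + 1))) / tvar) =
    ?i * Abs_fps (\<lambda>r. det (M_mat n r)) - ?i * (1 + fps_const tvar ^ (n + 1)) * Abs_fps (\<lambda>_. 1)"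
  proof (rule fps_ext)
    fix r
    have "1 + fps_const tvar ^ (n + 1) = fps_const (1 + tvar ^ (n + 1))"
      by (simp flip: fps_const_add)
    then show "fps_nth (Abs_fps (\<lambda>r. (det (M_mat n r) - (1 + tvar ^ (n + 1))) / tvar)) r =
      fps_nth (?i * Abs_fps (\<lambda>r. det (M_mat n r)) - ?i * (1 + fps_const tvar ^ (n + 1)) * Abs_fps (\<lambda>_. 1)) r"
      by (simp only: fps_const_mult fps_nth_Abs_fps fps_sub_nth fps_mult_left_const_nth)
        (simp add: divide_inverse algebra_simps)
  qed
  have "Q * (i * x - i * c * y) = - (c * (Q * y) * i) + Q * i * x" for Q i x c y :: "Qt fps"
    by (simp add: algebra_simps)
  then show ?thesis
    unfolding a_poly_eq weighted_count_det unfolding rhs div ones Suc_eq_plus1 by this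
qed

end
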